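(* Let $M$ be an LD-space and let $\mathcal{D}_M$ be the set of all definable subspaces of $M$, directed by inclusion. (i) The homomorphism $\psi:\varinjlim_{Y\in\mathcal{D}_M}H_n(Y)^{\mathcal{R}}\to H_n(M)^{\mathcal{R}}$, given by $\psi(\overline{c})=(i_Y)_*(c)$ for $c\in H_n(Y)^{\mathcal{R}}$ with $i_Y:Y\to M$ the inclusion, is an isomorphism. (ii) If $A$ is an admissible subspace of $M$, then the homomorphism $\widetilde{\psi}:\varinjlim_{Y\in\mathcal{D}_M}H_n(Y,A\cap Y)^{\mathcal{R}}\to H_n(M,A)^{\mathcal{R}}$, given by $\widetilde{\psi}(\overline{c})=i_*(c)$ for $c\in H_n(Y,A\cap Y)^{\mathcal{R}}$ with $i:(Y,A\cap Y)\to(M,A)$ the inclusion, is an isomorphism.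
   Context: Fix an o-minimal expansion $\mathcal{R}$ of a real closed field $R$; "definable" means definable with parameters, and definable maps are continuous. A locally definable space is a set $M$ with an atlas $(M_i,\phi_i)_{i\in I}$: $M=\bigcup M_i$, each $\phi_i:M_i\to Z_i$ is a bijection onto a definable $Z_i\subseteq R^{n(i)}$, each $\phi_i(M_i\cap M_j)$ is relatively open definable in $Z_i$, and the transitions $\phi_j\circ\phi_i^{-1}$ are definable. It has the topology making each $M_i$ open and each $\phi_i$ a homeomorphism. An ld-space is a Hausdorff such space. A definable subspace is a subset contained in finitely many charts whose images in those charts are definable; $A\subseteq M$ is admissible if each $\phi_i(A\cap M_i)$ is definable. An ld-map $f:M\to N$ is a map such that each $f(M_i)$ is a definable subspace and $f|_{M_i}$ is definable. An ld-space is regular if points have fundamental systems of closed neighbourhoods, and paracompact if there is a locally finite covering (each chart meets finitely many members) by open definable subspaces. An LD-space is a regular paracompact ld-space. $H_n(M)^{\mathcal{R}}$ (resp. $H_n(M,A)^{\mathcal{R}}$) is the homology of the chain complex freely generated by singular ld-simplices $\sigma:\Delta_k\to M$ ($\Delta_k$ the standard simplex over $R$), with the usual boundary (resp. of the quotient by chains in $A$). A definable subspace $Y$ inherits a definable space structure and $H_n(Y)^{\mathcal{R}}$ denotes its homology in the same sense. In the direct limit, $c_1\in H_n(Y_1)^{\mathcal{R}}$ and $c_2\in H_n(Y_2)^{\mathcal{R}}$ are identified iff their images agree in $H_n(Y_3)^{\mathcal{R}}$ for some $Y_3\supseteq Y_1\cup Y_2$ in $\mathcal{D}_M$. *)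

theory Defs
  imports "HOL-Homology.Simplices" "HOL-Analysis.Analysis"
begin

section \<open>O-minimal expansions of real closed fields\<close>

text \<open>Polynomials are written out as coefficient functions because the type of polynomials
  cannot be used inside a class specification.\<close>

class real_closed_field = linordered_field +
  assumes nonneg_has_sqrt: "0 \<le> a \<Longrightarrow> \<exists>b. b * b = a"
    and odd_degree_has_root:
      "odd n \<Longrightarrow> c n \<noteq> 0 \<Longrightarrow> \<exists>x. (\<Sum>k\<le>n. c k * x ^ k) = 0"

text \<open>First-order formulas of an expansion of an ordered field with carrier \<open>'r\<close>, with
  function symbols \<open>'f\<close>, relation symbols \<open>'p\<close> and a constant for every element of the field
  (parameters). Variables are de Bruijn indices. Symbols carry no arity: a symbol applied to
  lists of different lengths stands for different symbols.\<close>

datatype ('f, 'r) fo_term =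
    Var nat
  | Param 'r
  | Plus "('f, 'r) fo_term" "('f, 'r) fo_term"
  | Times "('f, 'r) fo_term" "('f, 'r) fo_term"
  | Fun 'f "('f, 'r) fo_term list"

datatype ('f, 'p, 'r) fo_formula =
    Eql "('f, 'r) fo_term" "('f, 'r) fo_term"
  | Less "('f, 'r) fo_term" "('f, 'r) fo_term"
  | Rel 'p "('f, 'r) fo_term list"
  | Neg "('f, 'p, 'r) fo_formula"
  | Conj "('f, 'p, 'r) fo_formula" "('f, 'p, 'r) fo_formula"
  | Exists "('f, 'p, 'r) fo_formula"

record ('f, 'p, 'r) expansion =
  fun_interp :: "'f \<Rightarrow> 'r list \<Rightarrow> 'r"
  rel_interp :: "'p \<Rightarrow> 'r list \<Rightarrow> bool"

primrec eval_term ::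
  "('f, 'p, 'r::linordered_field) expansion \<Rightarrow> (nat \<Rightarrow> 'r) \<Rightarrow> ('f, 'r) fo_term \<Rightarrow> 'r" where
  "eval_term R e (Var i) = e i"
| "eval_term R e (Param a) = a"
| "eval_term R e (Plus s t) = eval_term R e s + eval_term R e t"
| "eval_term R e (Times s t) = eval_term R e s * eval_term R e t"
| "eval_term R e (Fun f ts) = fun_interp R f (map (eval_term R e) ts)"

primrec sat ::
  "('f, 'p, 'r::linordered_field) expansion \<Rightarrow> (nat \<Rightarrow> 'r) \<Rightarrow> ('f, 'p, 'r) fo_formula \<Rightarrow> bool" where
  "sat R e (Eql s t) \<longleftrightarrow> eval_term R e s = eval_term R e t"
| "sat R e (Less s t) \<longleftrightarrow> eval_term R e s < eval_term R e t"
| "sat R e (Rel p ts) \<longleftrightarrow> rel_interp R p (map (eval_term R e) ts)"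
| "sat R e (Neg \<phi>) \<longleftrightarrow> \<not> sat R e \<phi>"
| "sat R e (Conj \<phi> \<psi>) \<longleftrightarrow> sat R e \<phi> \<and> sat R e \<psi>"
| "sat R e (Exists \<phi>) \<longleftrightarrow> (\<exists>a. sat R (case_nat a e) \<phi>)"

text \<open>As in \<^theory>\<open>HOL-Homology.Simplices\<close>, a point of \<open>R\<^sup>n\<close> is a function on the naturals that
  vanishes from \<open>n\<close> on.\<close>

definition Rn :: "nat \<Rightarrow> (nat \<Rightarrow> 'r::zero) set" where
  "Rn n = {x. \<forall>i\<ge>n. x i = 0}"

definition Rn_top :: "nat \<Rightarrow> (nat \<Rightarrow> 'r::{zero,topological_space}) topology" where
  "Rn_top n = subtopology (product_topology (\<lambda>_. euclidean) UNIV) (Rn n)"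

text \<open>The point \<open>(x, y)\<close> of \<open>R\<^sup>m\<^sup>+\<^sup>n\<close>, for \<open>x\<close> in \<open>R\<^sup>m\<close> and \<open>y\<close> in \<open>R\<^sup>n\<close>.\<close>

definition Rn_pair :: "nat \<Rightarrow> (nat \<Rightarrow> 'r) \<Rightarrow> (nat \<Rightarrow> 'r) \<Rightarrow> nat \<Rightarrow> 'r" where
  "Rn_pair m x y = (\<lambda>i. if i < m then x i else y (i - m))"

text \<open>Definable with parameters. Variables with index at least \<open>n\<close> are free to occur in the
  formula; they evaluate to the parameter 0.\<close>

definition definable ::
  "('f, 'p, 'r::linordered_field) expansion \<Rightarrow> nat \<Rightarrow> (nat \<Rightarrow> 'r) set \<Rightarrow> bool" where
  "definable R n A \<longleftrightarrow> (\<exists>\<phi>. A = {x \<in> Rn n. sat R x \<phi>})"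

text \<open>Definable maps are continuous by convention.\<close>

definition definable_map ::
  "('f, 'p, 'r::{linordered_field,linorder_topology}) expansion \<Rightarrow>
     nat \<Rightarrow> (nat \<Rightarrow> 'r) set \<Rightarrow> nat \<Rightarrow> (nat \<Rightarrow> 'r) set \<Rightarrow> ((nat \<Rightarrow> 'r) \<Rightarrow> nat \<Rightarrow> 'r) \<Rightarrow> bool" where
  "definable_map R m X n Y f \<longleftrightarrow>
     f \<in> X \<rightarrow> Y \<and>
     definable R (m + n) {Rn_pair m x (f x) | x. x \<in> X} \<and>
     continuous_map (subtopology (Rn_top m) X) (subtopology (Rn_top n) Y) f"

definition o_minimal :: "('f, 'p, 'r::linordered_field) expansion \<Rightarrow> bool" where
  "o_minimal R \<longleftrightarrow>
     (\<forall>A. definable R 1 A \<longrightarrow>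
        (\<exists>\<J>. finite \<J> \<and> (\<lambda>x. x 0) ` A = \<Union>\<J> \<and>
              (\<forall>J\<in>\<J>. \<exists>a b. J \<in> {{a}, {a<..<b}, {a<..}, {..<b}, UNIV})))"


section \<open>Locally definable spaces\<close>

record ('i, 'm, 'r) atlas =
  points :: "'m set"
  index :: "'i set"
  chart :: "'i \<Rightarrow> 'm set"
  chart_dim :: "'i \<Rightarrow> nat"
  coord :: "'i \<Rightarrow> 'm \<Rightarrow> nat \<Rightarrow> 'r"

definition coord_image :: "('i, 'm, 'r) atlas \<Rightarrow> 'i \<Rightarrow> (nat \<Rightarrow> 'r) set" where
  "coord_image M i = coord M i ` chart M i"

definition locally_definable_space ::
  "('f, 'p, 'r::{linordered_field,linorder_topology}) expansion \<Rightarrow> ('i, 'm, 'r) atlas \<Rightarrow> bool" where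
  "locally_definable_space R M \<longleftrightarrow>
     points M = (\<Union>i\<in>index M. chart M i) \<and>
     (\<forall>i\<in>index M. inj_on (coord M i) (chart M i) \<and> definable R (chart_dim M i) (coord_image M i)) \<and>
     (\<forall>i\<in>index M. \<forall>j\<in>index M.
        definable R (chart_dim M i) (coord M i ` (chart M i \<inter> chart M j)) \<and>
        openin (subtopology (Rn_top (chart_dim M i)) (coord_image M i))
          (coord M i ` (chart M i \<inter> chart M j)) \<and>
        definable_map R
          (chart_dim M i) (coord M i ` (chart M i \<inter> chart M j))
          (chart_dim M j) (coord M j ` (chart M i \<inter> chart M j))
          (coord M j \<circ> inv_into (chart M i) (coord M i)))"

definition ld_topology ::
  "('i, 'm, 'r::{linordered_field,linorder_topology}) atlas \<Rightarrow> 'm topology" where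
  "ld_topology M = topology (\<lambda>U. U \<subseteq> points M \<and>
     (\<forall>i\<in>index M. openin (subtopology (Rn_top (chart_dim M i)) (coord_image M i))
                    (coord M i ` (U \<inter> chart M i))))"

lemma openin_ld_topology:
  assumes inj: "\<And>i. i \<in> index M \<Longrightarrow> inj_on (coord M i) (chart M i)"
  shows "openin (ld_topology M) U \<longleftrightarrow> U \<subseteq> points M \<and>
     (\<forall>i\<in>index M. openin (subtopology (Rn_top (chart_dim M i)) (coord_image M i))
                    (coord M i ` (U \<inter> chart M i)))"
proof -
  have "istopology (\<lambda>U. U \<subseteq> points M \<and>
     (\<forall>i\<in>index M. openin (subtopology (Rn_top (chart_dim M i)) (coord_image M i))
                    (coord M i ` (U \<inter> chart M i))))"
    unfolding istopology_def
  proof (intro conjI allI impI ballI; (elim conjE)?)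
    fix S T i
    assume S: "\<forall>i\<in>index M. openin (subtopology (Rn_top (chart_dim M i)) (coord_image M i))
                    (coord M i ` (S \<inter> chart M i))"
      and T: "\<forall>i\<in>index M. openin (subtopology (Rn_top (chart_dim M i)) (coord_image M i))
                    (coord M i ` (T \<inter> chart M i))"
      and i: "i \<in> index M"
    have "coord M i ` (S \<inter> T \<inter> chart M i)
          = coord M i ` (S \<inter> chart M i) \<inter> coord M i ` (T \<inter> chart M i)"
      using inj[OF i] unfolding inj_on_def by blast
    then show "openin (subtopology (Rn_top (chart_dim M i)) (coord_image M i))
                    (coord M i ` (S \<inter> T \<inter> chart M i))"
      using S T i by (simp add: openin_Int)
  next
    fix \<K> i
    assume K: "\<forall>K\<in>\<K>. K \<subseteq> points M \<and> (\<forall>i\<in>index M.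
        openin (subtopology (Rn_top (chart_dim M i)) (coord_image M i)) (coord M i ` (K \<inter> chart M i)))"
      and i: "i \<in> index M"
    have "coord M i ` (\<Union>\<K> \<inter> chart M i) = \<Union>((\<lambda>K. coord M i ` (K \<inter> chart M i)) ` \<K>)"
      by blast
    then show "openin (subtopology (Rn_top (chart_dim M i)) (coord_image M i))
                    (coord M i ` (\<Union>\<K> \<inter> chart M i))"
      using K i by (auto intro: openin_Union)
  qed auto
  then show ?thesis
    unfolding ld_topology_def by (simp add: topology_inverse')
qed

lemma openin_ld_topology_chart:
  assumes M: "locally_definable_space R M" and i: "i \<in> index M"
  shows "openin (ld_topology M) (chart M i)"
proof -
  have "openin (ld_topology M) (chart M i) \<longleftrightarrow> chart M i \<subseteq> points M \<and>
     (\<forall>j\<in>index M. openin (subtopology (Rn_top (chart_dim M j)) (coord_image M j))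
                    (coord M j ` (chart M i \<inter> chart M j)))"
    using M by (intro openin_ld_topology) (simp add: locally_definable_space_def)
  also have "\<dots>"
    using M i by (auto simp: locally_definable_space_def Int_commute)
  finally show ?thesis by simp
qed

lemma homeomorphic_map_coord:
  assumes M: "locally_definable_space R M" and i: "i \<in> index M"
  shows "homeomorphic_map (subtopology (ld_topology M) (chart M i))
           (subtopology (Rn_top (chart_dim M i)) (coord_image M i)) (coord M i)"
proof -
  have inj: "inj_on (coord M i) (chart M i)" if "i \<in> index M" for i
    using M that by (simp add: locally_definable_space_def)
  note opn = openin_ld_topology[OF inj]
  let ?T = "\<lambda>i. subtopology (Rn_top (chart_dim M i)) (coord_image M i)"
  have chp: "chart M i \<subseteq> points M" using M i by (auto simp: locally_definable_space_def)
  have Z: "coord_image M j \<subseteq> Rn (chart_dim M j)" if "j \<in> index M" for j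
    using M that unfolding locally_definable_space_def definable_def by blast
  have tsZ: "topspace (?T j) = coord_image M j" if "j \<in> index M" for j
    using Z[OF that] by (auto simp: Rn_top_def)
  have tsM: "topspace (subtopology (ld_topology M) (chart M i)) = chart M i"
    using openin_subset[OF openin_ld_topology_chart[OF M i]] by auto
  have sub: "openin (subtopology (ld_topology M) (chart M i)) U \<longleftrightarrow>
        U \<subseteq> chart M i \<and> openin (ld_topology M) U" for U
    using openin_ld_topology_chart[OF M i] by (metis openin_open_subtopology)
  have key: "openin (ld_topology M) {x \<in> chart M i. coord M i x \<in> W}"
    if W: "openin (?T i) W" for W
  proof -
    have "openin (?T j) (coord M j ` ({x \<in> chart M i. coord M i x \<in> W} \<inter> chart M j))"
      if j: "j \<in> index M" for j
    proof -
      let ?A = "coord M j ` (chart M i \<inter> chart M j)"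
      let ?g = "coord M i \<circ> inv_into (chart M j) (coord M j)"
      have oA: "openin (?T j) ?A" and 
        c: "continuous_map (subtopology (Rn_top (chart_dim M j)) ?A)
              (subtopology (Rn_top (chart_dim M i)) (coord M i ` (chart M i \<inter> chart M j))) ?g"
        using M i j unfolding locally_definable_space_def definable_map_def
        by (auto simp: Int_commute)
      have c': "continuous_map (subtopology (Rn_top (chart_dim M j)) ?A) (?T i) ?g"
        using c unfolding continuous_map_in_subtopology coord_image_def by auto
      have o: "openin (subtopology (Rn_top (chart_dim M j)) ?A)
          {x \<in> topspace (subtopology (Rn_top (chart_dim M j)) ?A). ?g x \<in> W}"
        using c' W by (simp add: continuous_map_def)
      have AZ: "?A \<subseteq> coord_image M j" by (auto simp: coord_image_def)
      have tsA: "topspace (subtopology (Rn_top (chart_dim M j)) ?A) = ?A"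
        using AZ Z[OF j] by (auto simp: Rn_top_def)
      have eq: "{x \<in> ?A. ?g x \<in> W} = coord M j ` ({x \<in> chart M i. coord M i x \<in> W} \<inter> chart M j)"
        using inj[OF j] by auto
      have st: "subtopology (Rn_top (chart_dim M j)) ?A = subtopology (?T j) ?A"
        using AZ by (simp add: subtopology_subtopology inf_absorb2)
      have "openin (subtopology (Rn_top (chart_dim M j)) ?A)
          (coord M j ` ({x \<in> chart M i. coord M i x \<in> W} \<inter> chart M j))"
        using o unfolding tsA eq .
      then show ?thesis
        unfolding st openin_open_subtopology[OF oA] by blast
    qed
    then show ?thesis using chp by (subst opn) auto
  qed
  have img: "coord M i ` U \<subseteq> coord_image M i" if "U \<subseteq> chart M i" for U
    using that by (auto simp: coord_image_def)
  show ?thesis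
    unfolding homeomorphic_map_def quotient_map_def tsM tsZ[OF i]
  proof (intro conjI allI impI inj[OF i])
    show "coord M i ` chart M i = coord_image M i" by (simp add: coord_image_def)
    fix W assume W: "W \<subseteq> coord_image M i"
    let ?U = "{x \<in> chart M i. coord M i x \<in> W}"
    have e: "coord M i ` (?U \<inter> chart M i) = W" using W by (auto simp: coord_image_def)
    show "openin (subtopology (ld_topology M) (chart M i)) ?U = openin (?T i) W"
    proof
      assume "openin (subtopology (ld_topology M) (chart M i)) ?U"
      then have "openin (ld_topology M) ?U" by (simp add: sub)
      then show "openin (?T i) W" using i e by (subst (asm) opn) auto
    next
      assume "openin (?T i) W"
      then show "openin (subtopology (ld_topology M) (chart M i)) ?U" using key by (simp add: sub)
    qed
  qed
qed

definition definable_subspace ::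
  "('f, 'p, 'r::linordered_field) expansion \<Rightarrow> ('i, 'm, 'r) atlas \<Rightarrow> 'm set \<Rightarrow> bool" where
  "definable_subspace R M Y \<longleftrightarrow>
     (\<exists>J. finite J \<and> J \<subseteq> index M \<and> Y \<subseteq> (\<Union>j\<in>J. chart M j) \<and>
          (\<forall>j\<in>J. definable R (chart_dim M j) (coord M j ` (Y \<inter> chart M j))))"

definition admissible_subspace ::
  "('f, 'p, 'r::linordered_field) expansion \<Rightarrow> ('i, 'm, 'r) atlas \<Rightarrow> 'm set \<Rightarrow> bool" where
  "admissible_subspace R M A \<longleftrightarrow>
     A \<subseteq> points M \<and> (\<forall>i\<in>index M. definable R (chart_dim M i) (coord M i ` (A \<inter> chart M i)))"

text \<open>The structure inherited by a definable (or admissible) subspace. The traces of all charts are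
  kept; for a definable subspace finitely many of them already cover and give an equivalent
  atlas, so that it is a definable space.\<close>

definition ld_subspace :: "('i, 'm, 'r) atlas \<Rightarrow> 'm set \<Rightarrow> ('i, 'm, 'r) atlas" where
  "ld_subspace M Y = M\<lparr>points := Y, chart := (\<lambda>i. chart M i \<inter> Y)\<rparr>"

text \<open>Definability of the restriction of \<open>f\<close> to a chart is definability of its graph in the
  product charts, together with continuity.\<close>

definition ld_map ::
  "('f, 'p, 'r::{linordered_field,linorder_topology}) expansion \<Rightarrow>
     ('i, 'm, 'r) atlas \<Rightarrow> ('j, 'n, 'r) atlas \<Rightarrow> ('m \<Rightarrow> 'n) \<Rightarrow> bool" where
  "ld_map R M N f \<longleftrightarrow>
     f \<in> points M \<rightarrow> points N \<and>
     (\<forall>i\<in>index M.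
        definable_subspace R N (f ` chart M i) \<and>
        continuous_map (subtopology (ld_topology M) (chart M i)) (ld_topology N) f \<and>
        (\<forall>j\<in>index N. definable R (chart_dim M i + chart_dim N j)
           {Rn_pair (chart_dim M i) (coord M i x) (coord N j (f x)) | x.
              x \<in> chart M i \<and> f x \<in> chart N j}))"

definition ld_space ::
  "('f, 'p, 'r::{linordered_field,linorder_topology}) expansion \<Rightarrow> ('i, 'm, 'r) atlas \<Rightarrow> bool" where
  "ld_space R M \<longleftrightarrow> locally_definable_space R M \<and> Hausdorff_space (ld_topology M)"

definition ld_regular ::
  "('i, 'm, 'r::{linordered_field,linorder_topology}) atlas \<Rightarrow> bool" where
  "ld_regular M \<longleftrightarrow> neighbourhood_base_of (closedin (ld_topology M)) (ld_topology M)"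

definition ld_paracompact ::
  "('f, 'p, 'r::{linordered_field,linorder_topology}) expansion \<Rightarrow> ('i, 'm, 'r) atlas \<Rightarrow> bool" where
  "ld_paracompact R M \<longleftrightarrow>
     (\<exists>\<U>. \<Union>\<U> = points M \<and>
          (\<forall>U\<in>\<U>. openin (ld_topology M) U \<and> definable_subspace R M U) \<and>
          (\<forall>i\<in>index M. finite {U\<in>\<U>. U \<inter> chart M i \<noteq> {}}))"

definition LD_space ::
  "('f, 'p, 'r::{linordered_field,linorder_topology}) expansion \<Rightarrow> ('i, 'm, 'r) atlas \<Rightarrow> bool" where
  "LD_space R M \<longleftrightarrow> ld_space R M \<and> ld_regular M \<and> ld_paracompact R M"


section \<open>Homology of chain complexes of abelian groups\<close>

text \<open>In a complex, \<open>bd C n\<close> maps \<open>grp C n\<close> to \<open>grp C (n - 1)\<close>; as \<open>0 - 1 = 0\<close>, the map \<open>bd C 0\<close> is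
  required to be zero.\<close>

record 'a complex_of_groups =
  grp :: "nat \<Rightarrow> 'a monoid"
  bd :: "nat \<Rightarrow> 'a \<Rightarrow> 'a"

definition boundaries :: "'a complex_of_groups \<Rightarrow> nat \<Rightarrow> 'a set" where
  "boundaries C n = bd C (Suc n) ` carrier (grp C (Suc n))"

definition homology :: "'a complex_of_groups \<Rightarrow> nat \<Rightarrow> 'a set monoid" where
  "homology C n =
     (grp C n)\<lparr>carrier := kernel (grp C n) (grp C (n - 1)) (bd C n)\<rparr> Mod boundaries C n"

text \<open>The map of cosets induced by \<open>f\<close>, where the target is taken modulo \<open>H\<close>: the coset of \<open>x\<close> goes to
  the coset of \<open>f x\<close>.\<close>

definition coset_map :: "'b monoid \<Rightarrow> 'b set \<Rightarrow> ('a \<Rightarrow> 'b) \<Rightarrow> 'a set \<Rightarrow> 'b set" where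
  "coset_map G H f X = (\<Union>x\<in>X. H #>\<^bsub>G\<^esub> f x)"

definition quotient_complex ::
  "'a complex_of_groups \<Rightarrow> 'a complex_of_groups \<Rightarrow> 'a set complex_of_groups" where
  "quotient_complex C D =
     \<lparr>grp = (\<lambda>n. grp C n Mod carrier (grp D n)),
      bd = (\<lambda>n. coset_map (grp C (n - 1)) (carrier (grp D (n - 1))) (bd C n))\<rparr>"

definition homology_map ::
  "'b complex_of_groups \<Rightarrow> nat \<Rightarrow> ('a \<Rightarrow> 'b) \<Rightarrow> 'a set \<Rightarrow> 'b set" where
  "homology_map C n f = coset_map (grp C n) (boundaries C n) f"


section \<open>Singular homology of locally definable spaces\<close>

definition simplex_set :: "nat \<Rightarrow> (nat \<Rightarrow> 'r::linordered_field) set" where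
  "simplex_set k = {x \<in> Rn (Suc k). (\<forall>i. 0 \<le> x i) \<and> (\<Sum>i\<le>k. x i) = 1}"

definition simplex_space :: "nat \<Rightarrow> (unit, nat \<Rightarrow> 'r::linordered_field, 'r) atlas" where
  "simplex_space k =
     \<lparr>points = simplex_set k, index = {()}, chart = (\<lambda>_. simplex_set k),
      chart_dim = (\<lambda>_. Suc k), coord = (\<lambda>_ x. x)\<rparr>"

definition ld_simplices ::
  "('f, 'p, 'r::{linordered_field,linorder_topology}) expansion \<Rightarrow> ('i, 'm, 'r) atlas \<Rightarrow>
     nat \<Rightarrow> ((nat \<Rightarrow> 'r) \<Rightarrow> 'm) set" where
  "ld_simplices R M k = {\<sigma> \<in> extensional (simplex_set k). ld_map R (simplex_space k) M \<sigma>}"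

definition ld_face ::
  "nat \<Rightarrow> nat \<Rightarrow> ((nat \<Rightarrow> 'r::linordered_field) \<Rightarrow> 'm) \<Rightarrow> (nat \<Rightarrow> 'r) \<Rightarrow> 'm" where
  "ld_face k j \<sigma> = restrict (\<sigma> \<circ> simplical_face j) (simplex_set (k - 1))"

type_synonym ('r, 'm) ld_chain = "((nat \<Rightarrow> 'r) \<Rightarrow> 'm) \<Rightarrow>\<^sub>0 int"

definition ld_boundary ::
  "nat \<Rightarrow> ('r::linordered_field, 'm) ld_chain \<Rightarrow> ('r, 'm) ld_chain" where
  "ld_boundary k c =
     (if k = 0 then 0
      else frag_extend (\<lambda>\<sigma>. \<Sum>j\<le>k. frag_cmul ((-1) ^ j) (frag_of (ld_face k j \<sigma>))) c)"

definition ld_chains ::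
  "('f, 'p, 'r::{linordered_field,linorder_topology}) expansion \<Rightarrow> ('i, 'm, 'r) atlas \<Rightarrow>
     ('r, 'm) ld_chain complex_of_groups" where
  "ld_chains R M =
     \<lparr>grp = (\<lambda>k. free_Abelian_group (ld_simplices R M k)), bd = ld_boundary\<rparr>"

definition ld_rel_chains ::
  "('f, 'p, 'r::{linordered_field,linorder_topology}) expansion \<Rightarrow> ('i, 'm, 'r) atlas \<Rightarrow> 'm set \<Rightarrow>
     ('r, 'm) ld_chain set complex_of_groups" where
  "ld_rel_chains R M A = quotient_complex (ld_chains R M) (ld_chains R (ld_subspace M A))"

text \<open>The chain map of \<open>g\<close> in degree \<open>k\<close>.\<close>

definition ld_chain_map ::
  "nat \<Rightarrow> ('m \<Rightarrow> 'n) \<Rightarrow> ('r::linordered_field, 'm) ld_chain \<Rightarrow> ('r, 'n) ld_chain" where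
  "ld_chain_map k g = frag_extend (\<lambda>\<sigma>. frag_of (restrict (g \<circ> \<sigma>) (simplex_set k)))"

definition ld_homology ::
  "('f, 'p, 'r::{linordered_field,linorder_topology}) expansion \<Rightarrow> ('i, 'm, 'r) atlas \<Rightarrow> nat \<Rightarrow>
     ('r, 'm) ld_chain set monoid" where
  "ld_homology R M n = homology (ld_chains R M) n"

definition ld_rel_homology ::
  "('f, 'p, 'r::{linordered_field,linorder_topology}) expansion \<Rightarrow> ('i, 'm, 'r) atlas \<Rightarrow> 'm set \<Rightarrow>
     nat \<Rightarrow> ('r, 'm) ld_chain set set monoid" where
  "ld_rel_homology R M A n = homology (ld_rel_chains R M A) n"

text \<open>The maps induced on homology by an ld-map \<open>g\<close> into \<open>N\<close>, and by an ld-map of pairs \<open>g\<close> into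
  \<open>(N, B)\<close>.\<close>

definition ld_homology_map ::
  "('f, 'p, 'r::{linordered_field,linorder_topology}) expansion \<Rightarrow> ('j, 'n, 'r) atlas \<Rightarrow> nat \<Rightarrow>
     ('m \<Rightarrow> 'n) \<Rightarrow> ('r, 'm) ld_chain set \<Rightarrow> ('r, 'n) ld_chain set" where
  "ld_homology_map R N n g = homology_map (ld_chains R N) n (ld_chain_map n g)"

definition ld_rel_homology_map ::
  "('f, 'p, 'r::{linordered_field,linorder_topology}) expansion \<Rightarrow> ('j, 'n, 'r) atlas \<Rightarrow> 'n set \<Rightarrow>
     nat \<Rightarrow> ('m \<Rightarrow> 'n) \<Rightarrow> ('r, 'm) ld_chain set set \<Rightarrow> ('r, 'n) ld_chain set set" where
  "ld_rel_homology_map R N B n g =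
     homology_map (ld_rel_chains R N B) n
       (coset_map (grp (ld_chains R N) n) (carrier (grp (ld_chains R (ld_subspace N B)) n))
         (ld_chain_map n g))"


section \<open>Direct limits over directed families of sets\<close>

text \<open>\<open>G Y\<close> are groups indexed by the members \<open>Y\<close> of a family \<open>D\<close> directed by inclusion, and \<open>t Y Z\<close>
  is the transition homomorphism for \<open>Y \<subseteq> Z\<close>. The limit consists of classes of pairs \<open>(Y, c)\<close>
  with \<open>c\<close> in \<open>G Y\<close>.\<close>

definition dirlim_rel ::
  "'m set set \<Rightarrow> ('m set \<Rightarrow> 'g monoid) \<Rightarrow> ('m set \<Rightarrow> 'm set \<Rightarrow> 'g \<Rightarrow> 'g) \<Rightarrow>
     (('m set \<times> 'g) \<times> ('m set \<times> 'g)) set" where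
  "dirlim_rel D G t =
     {((Y1, c1), (Y2, c2)).
        Y1 \<in> D \<and> c1 \<in> carrier (G Y1) \<and> Y2 \<in> D \<and> c2 \<in> carrier (G Y2) \<and>
        (\<exists>Y3\<in>D. Y1 \<union> Y2 \<subseteq> Y3 \<and> t Y1 Y3 c1 = t Y2 Y3 c2)}"

definition dirlim_class ::
  "'m set set \<Rightarrow> ('m set \<Rightarrow> 'g monoid) \<Rightarrow> ('m set \<Rightarrow> 'm set \<Rightarrow> 'g \<Rightarrow> 'g) \<Rightarrow>
     'm set \<Rightarrow> 'g \<Rightarrow> ('m set \<times> 'g) set" where
  "dirlim_class D G t Y c = dirlim_rel D G t `` {(Y, c)}"

text \<open>The unions in the group operations range over all choices of representatives; for a directed
  system all members are equal.\<close>

definition dirlim ::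
  "'m set set \<Rightarrow> ('m set \<Rightarrow> 'g monoid) \<Rightarrow> ('m set \<Rightarrow> 'm set \<Rightarrow> 'g \<Rightarrow> 'g) \<Rightarrow>
     ('m set \<times> 'g) set monoid" where
  "dirlim D G t =
     \<lparr>carrier = (SIGMA Y:D. carrier (G Y)) // dirlim_rel D G t,
      monoid.mult = (\<lambda>X1 X2. \<Union>(Y1, c1)\<in>X1. \<Union>(Y2, c2)\<in>X2. \<Union>Y3\<in>{Y3\<in>D. Y1 \<union> Y2 \<subseteq> Y3}.
                dirlim_class D G t Y3 (t Y1 Y3 c1 \<otimes>\<^bsub>G Y3\<^esub> t Y2 Y3 c2)),
      one = (\<Union>Y\<in>D. dirlim_class D G t Y \<one>\<^bsub>G Y\<^esub>)\<rparr>"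

text \<open>The map on the limit sending the class of \<open>(Y, c)\<close> to \<open>u Y c\<close>.\<close>

definition dirlim_map :: "('m set \<Rightarrow> 'g \<Rightarrow> 'h) \<Rightarrow> ('m set \<times> 'g) set \<Rightarrow> 'h" where
  "dirlim_map u X = the_elem ((\<lambda>(Y, c). u Y c) ` X)"


section \<open>The direct systems of definable subspaces\<close>

definition definable_subspaces ::
  "('f, 'p, 'r::linordered_field) expansion \<Rightarrow> ('i, 'm, 'r) atlas \<Rightarrow> 'm set set" where
  "definable_subspaces R M = {Y. definable_subspace R M Y}"

definition sub_homology ::
  "('f, 'p, 'r::{linordered_field,linorder_topology}) expansion \<Rightarrow> ('i, 'm, 'r) atlas \<Rightarrow> nat \<Rightarrow>
     'm set \<Rightarrow> ('r, 'm) ld_chain set monoid" where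
  "sub_homology R M n Y = ld_homology R (ld_subspace M Y) n"

definition sub_rel_homology ::
  "('f, 'p, 'r::{linordered_field,linorder_topology}) expansion \<Rightarrow> ('i, 'm, 'r) atlas \<Rightarrow> 'm set \<Rightarrow>
     nat \<Rightarrow> 'm set \<Rightarrow> ('r, 'm) ld_chain set set monoid" where
  "sub_rel_homology R M A n Y = ld_rel_homology R (ld_subspace M Y) (A \<inter> Y) n"

definition incl_homology ::
  "('f, 'p, 'r::{linordered_field,linorder_topology}) expansion \<Rightarrow> ('i, 'm, 'r) atlas \<Rightarrow> nat \<Rightarrow>
     'm set \<Rightarrow> 'm set \<Rightarrow> ('r, 'm) ld_chain set \<Rightarrow> ('r, 'm) ld_chain set" where
  "incl_homology R M n Y Z = ld_homology_map R (ld_subspace M Z) n id"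

definition incl_rel_homology ::
  "('f, 'p, 'r::{linordered_field,linorder_topology}) expansion \<Rightarrow> ('i, 'm, 'r) atlas \<Rightarrow> 'm set \<Rightarrow>
     nat \<Rightarrow> 'm set \<Rightarrow> 'm set \<Rightarrow>
     ('r, 'm) ld_chain set set \<Rightarrow> ('r, 'm) ld_chain set set" where
  "incl_rel_homology R M A n Y Z = ld_rel_homology_map R (ld_subspace M Z) (A \<inter> Z) n id"

definition psi ::
  "('f, 'p, 'r::{linordered_field,linorder_topology}) expansion \<Rightarrow> ('i, 'm, 'r) atlas \<Rightarrow> nat \<Rightarrow>
     ('m set \<times> ('r, 'm) ld_chain set) set \<Rightarrow> ('r, 'm) ld_chain set" where
  "psi R M n = dirlim_map (\<lambda>Y. ld_homology_map R M n id)"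

definition psi_rel ::
  "('f, 'p, 'r::{linordered_field,linorder_topology}) expansion \<Rightarrow> ('i, 'm, 'r) atlas \<Rightarrow> 'm set \<Rightarrow>
     nat \<Rightarrow> ('m set \<times> ('r, 'm) ld_chain set set) set \<Rightarrow> ('r, 'm) ld_chain set set" where
  "psi_rel R M A n = dirlim_map (\<lambda>Y. ld_rel_homology_map R M A n id)"

end

theory Submission
  imports Defs
begin

text \<open>The image of a single ld-simplex is a definable subspace, because this is part of what it
  means to be an ld-map on a definable space. As finite unions of definable subspaces are definable
  subspaces, every singular chain of \<open>M\<close> is a chain of some definable subspace \<open>Y\<close>, and a simplex of
  \<open>M\<close> with image in \<open>Y\<close> is the same as a simplex of \<open>Y\<close>. So the chain complex of \<open>M\<close> is the directed
  colimit of those of the \<open>Y\<close>, and the same holds for the quotients by chains in \<open>A\<close> since a chain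
  lying both in \<open>Y\<close> and in \<open>A\<close> lies in \<open>A \<inter> Y\<close>. Directed colimits of abelian groups are exact, hence
  commute with homology.\<close>

section \<open>Directed colimits and homology\<close>

text \<open>Exactness is used elementwise. The conditions \<open>u_surj\<close> and
  \<open>u_ker\<close> on a cocone pass from chains to cycles and to quotients by subgroups, each
  time by moving a representative to a larger \<open>Y\<close> in which an identity valid in the
  limit already holds. The comparison with the concrete group \<open>dirlim\<close> is made once,
  for any such cocone, so the absolute and the relative case differ only in the complexes inserted.
  In the relative case quotients are formed twice: chains modulo chains in \<open>A\<close>, then
  cycles modulo boundaries. On chains every inclusion acts as the identity, but the group of
  boundaries grows with \<open>Y\<close>, so on homology the transition maps enlarge cosets and may
  have a kernel. The geometric work lies in two facts: definable subspaces are closed under finite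
  unions, and faces of ld-simplices are ld-simplices. Both require images to be definable, which
  comes from projecting graphs with first-order quantifiers.\<close>

lemma coset_map_r_coset:
  assumes "group G" "group K" "f \<in> hom G K" "subgroup H G" "subgroup N K" "f ` H \<subseteq> N"
    and x: "x \<in> carrier G"
  shows "coset_map K N f (H #>\<^bsub>G\<^esub> x) = N #>\<^bsub>K\<^esub> f x"
proof -
  interpret G: group G by fact
  interpret K: group K by fact
  have H: "H \<subseteq> carrier G" and N: "N \<subseteq> carrier K"
    using assms by (auto dest: subgroup.subset)
  \<comment> \<open>\<open>coset_map\<close> is a union over all representatives \<open>h x\<close>
    of the coset. Each contributes the same coset, because \<open>f h\<close> is absorbed by
    \<open>N\<close>; and the union is not empty, because \<open>H\<close> contains the
    unit.\<close>
  have "N #>\<^bsub>K\<^esub> f (h \<otimes>\<^bsub>G\<^esub> x) = N #>\<^bsub>K\<^esub> f x" if h: "h \<in> H" for h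
  proof -
    have fh: "f h \<in> N" using h assms by blast
    have "f (h \<otimes>\<^bsub>G\<^esub> x) = f h \<otimes>\<^bsub>K\<^esub> f x"
      using h H x assms(3) by (auto simp: hom_mult)
    then have "N #>\<^bsub>K\<^esub> f (h \<otimes>\<^bsub>G\<^esub> x) = (N #>\<^bsub>K\<^esub> f h) #>\<^bsub>K\<^esub> f x"
      using N fh x assms(3) by (simp add: K.coset_mult_assoc hom_in_carrier subsetD)
    also have "N #>\<^bsub>K\<^esub> f h = N"
      using fh N assms(5) by (intro K.coset_join2) auto
    finally show ?thesis .
  qed
  moreover have "\<one>\<^bsub>G\<^esub> \<in> H" using assms by (simp add: subgroup.one_closed)
  ultimately show ?thesis
    unfolding coset_map_def r_coset_def[of G] by auto
qed

text \<open>Commutativity makes \<open>H\<close> and \<open>N\<close> normal, so cosets multiply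
  through their representatives and \<open>coset_map_r_coset\<close> reduces the claim to
  \<open>f\<close> being a homomorphism.\<close>

lemma coset_map_hom:
  assumes "comm_group G" "comm_group K" "f \<in> hom G K" "subgroup H G" "subgroup N K" "f ` H \<subseteq> N"
  shows "coset_map K N f \<in> hom (G Mod H) (K Mod N)"
proof -
  interpret G: comm_group G by fact
  interpret K: comm_group K by fact
  interpret H: normal H G using assms by (simp add: G.subgroup_imp_normal)
  interpret N: normal N K using assms by (simp add: K.subgroup_imp_normal)
  note [simp] = coset_map_r_coset[OF G.is_group K.is_group assms(3-6)]
  show ?thesis
    using assms(3)
    by (auto intro!: homI imageI simp: carrier_FactGroup H.rcos_sum N.rcos_sum hom_mult hom_in_carrier)
qed

text \<open>A cocone satisfying the elementwise characterisation of a colimit: \<open>u_surj\<close> and \<open>u_ker\<close> say that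
  \<open>L\<close> is the directed colimit of the \<open>G Y\<close>.\<close>

locale directed_cocone =
  fixes D :: "'m set set"
    and G :: "'m set \<Rightarrow> 'g monoid"
    and t :: "'m set \<Rightarrow> 'm set \<Rightarrow> 'g \<Rightarrow> 'g"
    and L :: "'h monoid"
    and u :: "'m set \<Rightarrow> 'g \<Rightarrow> 'h"
  assumes ne: "D \<noteq> {}"
    and directed: "Y \<in> D \<Longrightarrow> Z \<in> D \<Longrightarrow> \<exists>W\<in>D. Y \<union> Z \<subseteq> W"
    and grp_G: "Y \<in> D \<Longrightarrow> comm_group (G Y)"
    and grp_L: "comm_group L"
    and t_hom: "Y \<in> D \<Longrightarrow> Z \<in> D \<Longrightarrow> Y \<subseteq> Z \<Longrightarrow> t Y Z \<in> hom (G Y) (G Z)"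
    and t_comp: "Y \<in> D \<Longrightarrow> Z \<in> D \<Longrightarrow> W \<in> D \<Longrightarrow> Y \<subseteq> Z \<Longrightarrow> Z \<subseteq> W \<Longrightarrow> c \<in> carrier (G Y) \<Longrightarrow>
                  t Z W (t Y Z c) = t Y W c"
    and u_hom: "Y \<in> D \<Longrightarrow> u Y \<in> hom (G Y) L"
    and u_t: "Y \<in> D \<Longrightarrow> Z \<in> D \<Longrightarrow> Y \<subseteq> Z \<Longrightarrow> c \<in> carrier (G Y) \<Longrightarrow> u Z (t Y Z c) = u Y c"
    and u_surj: "x \<in> carrier L \<Longrightarrow> \<exists>Y\<in>D. \<exists>c\<in>carrier (G Y). u Y c = x"
    and u_ker: "Y \<in> D \<Longrightarrow> c \<in> carrier (G Y) \<Longrightarrow> u Y c = \<one>\<^bsub>L\<^esub> \<Longrightarrow>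
                  \<exists>Z\<in>D. Y \<subseteq> Z \<and> t Y Z c = \<one>\<^bsub>G Z\<^esub>"
begin

section \<open>Comparison of the concrete direct limit with the apex of the cocone\<close>

lemma group_G: "Y \<in> D \<Longrightarrow> group (G Y)"
  using grp_G by (simp add: comm_group.axioms)

lemma group_L: "group L"
  using grp_L by (simp add: comm_group.axioms)

lemma t_closed: "Y \<in> D \<Longrightarrow> Z \<in> D \<Longrightarrow> Y \<subseteq> Z \<Longrightarrow> c \<in> carrier (G Y) \<Longrightarrow> t Y Z c \<in> carrier (G Z)"
  using t_hom by (rule hom_in_carrier)

lemma u_closed: "Y \<in> D \<Longrightarrow> c \<in> carrier (G Y) \<Longrightarrow> u Y c \<in> carrier L"
  using u_hom by (rule hom_in_carrier)

lemma t_one: "Y \<in> D \<Longrightarrow> Z \<in> D \<Longrightarrow> Y \<subseteq> Z \<Longrightarrow> t Y Z \<one>\<^bsub>G Y\<^esub> = \<one>\<^bsub>G Z\<^esub>"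
  using hom_one[OF t_hom] group_G by simp

lemma u_one: "Y \<in> D \<Longrightarrow> u Y \<one>\<^bsub>G Y\<^esub> = \<one>\<^bsub>L\<^esub>"
  using hom_one[OF u_hom] group_G group_L by simp

text \<open>\<open>u_ker\<close> only detects elements that become trivial. So both elements are
  moved to a common \<open>W\<close>, where their quotient is killed by \<open>u W\<close> and hence
  by some \<open>t W Z\<close>; \<open>t_comp\<close> turns this into an equation at
  \<open>Z\<close>.\<close>

lemma u_eq_iff:
  assumes Y: "Y1 \<in> D" "Y2 \<in> D" and c: "c1 \<in> carrier (G Y1)" "c2 \<in> carrier (G Y2)"
  shows "u Y1 c1 = u Y2 c2 \<longleftrightarrow> (\<exists>Z\<in>D. Y1 \<union> Y2 \<subseteq> Z \<and> t Y1 Z c1 = t Y2 Z c2)"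
proof
  assume eq: "u Y1 c1 = u Y2 c2"
  obtain W where W: "W \<in> D" "Y1 \<subseteq> W" "Y2 \<subseteq> W" using directed[OF Y] by auto
  let ?a = "t Y1 W c1" and ?b = "t Y2 W c2"
  interpret W: group "G W" using W group_G by simp
  interpret L: group L by (rule group_L)
  interpret uW: group_hom "G W" L "u W"
    using W u_hom by unfold_locales
  have ab: "?a \<in> carrier (G W)" "?b \<in> carrier (G W)" using W Y c t_closed by auto
  have "u W (?a \<otimes>\<^bsub>G W\<^esub> inv\<^bsub>G W\<^esub> ?b) = u Y1 c1 \<otimes>\<^bsub>L\<^esub> inv\<^bsub>L\<^esub> u Y2 c2"
    using ab W Y c u_t by simp
  also have "\<dots> = \<one>\<^bsub>L\<^esub>" using eq Y c u_closed by simp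
  finally obtain Z where Z: "Z \<in> D" "W \<subseteq> Z" "t W Z (?a \<otimes>\<^bsub>G W\<^esub> inv\<^bsub>G W\<^esub> ?b) = \<one>\<^bsub>G Z\<^esub>"
    using u_ker[OF W(1)] ab by (metis W.inv_closed W.m_closed)
  interpret Z: group "G Z" using Z group_G by simp
  interpret tWZ: group_hom "G W" "G Z" "t W Z"
    using W Z t_hom by unfold_locales
  have "t W Z ?a \<otimes>\<^bsub>G Z\<^esub> inv\<^bsub>G Z\<^esub> t W Z ?b = \<one>\<^bsub>G Z\<^esub>" using Z(3) ab by simp
  then have "t W Z ?a = t W Z ?b"
    using ab by (metis Z.inv_equality Z.inv_inv tWZ.hom_closed Z.inv_closed)
  then have "t Y1 Z c1 = t Y2 Z c2" using t_comp W Z Y c by simp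
  then show "\<exists>Z\<in>D. Y1 \<union> Y2 \<subseteq> Z \<and> t Y1 Z c1 = t Y2 Z c2" using W Z by blast
next
  assume "\<exists>Z\<in>D. Y1 \<union> Y2 \<subseteq> Z \<and> t Y1 Z c1 = t Y2 Z c2"
  then show "u Y1 c1 = u Y2 c2" using u_t Y c by (metis Un_subset_iff)
qed

text \<open>The class in \<open>dirlim\<close> that corresponds to \<open>x\<close>. Describing
  classes as fibres of \<open>u\<close> replaces separate proofs that \<open>dirlim_rel\<close> is
  an equivalence relation and that the operation respects it: by \<open>u_eq_iff\<close>, two pairs
  are related exactly when \<open>u\<close> gives them the same value.\<close>

definition fibre :: "'h \<Rightarrow> ('m set \<times> 'g) set" where
  "fibre x = {(Y, c). Y \<in> D \<and> c \<in> carrier (G Y) \<and> u Y c = x}"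

lemma dirlim_class_eq_fibre:
  assumes Y: "Y \<in> D" and c: "c \<in> carrier (G Y)"
  shows "dirlim_class D G t Y c = fibre (u Y c)"
proof -
  have "(Z, d) \<in> dirlim_class D G t Y c \<longleftrightarrow> (Z, d) \<in> fibre (u Y c)" for Z d
  proof -
    have "(Z, d) \<in> dirlim_class D G t Y c \<longleftrightarrow>
        Z \<in> D \<and> d \<in> carrier (G Z) \<and> (\<exists>W\<in>D. Y \<union> Z \<subseteq> W \<and> t Y W c = t Z W d)"
      using Y c by (simp add: dirlim_class_def dirlim_rel_def)
    also have "\<dots> \<longleftrightarrow> Z \<in> D \<and> d \<in> carrier (G Z) \<and> u Y c = u Z d"
      using u_eq_iff[OF Y _ c] by blast
    also have "\<dots> \<longleftrightarrow> (Z, d) \<in> fibre (u Y c)"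
      unfolding fibre_def by auto
    finally show ?thesis .
  qed
  then show ?thesis by auto
qed

lemma carrier_dirlim: "carrier (dirlim D G t) = fibre ` carrier L"
proof -
  have "carrier (dirlim D G t) = (\<lambda>(Y, c). dirlim_class D G t Y c) ` (SIGMA Y:D. carrier (G Y))"
    by (auto simp: dirlim_def quotient_def dirlim_class_def)
  also have "\<dots> = (\<lambda>(Y, c). fibre (u Y c)) ` (SIGMA Y:D. carrier (G Y))"
    by (intro image_cong) (auto simp: dirlim_class_eq_fibre)
  also have "\<dots> = fibre ` carrier L"
    using u_closed u_surj by (fastforce simp: image_iff)
  finally show ?thesis .
qed

lemma mult_dirlim:
  assumes x: "x \<in> carrier L" and y: "y \<in> carrier L"
  shows "fibre x \<otimes>\<^bsub>dirlim D G t\<^esub> fibre y = fibre (x \<otimes>\<^bsub>L\<^esub> y)"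
proof -
  have cl: "dirlim_class D G t Z (t Y1 Z c1 \<otimes>\<^bsub>G Z\<^esub> t Y2 Z c2) = fibre (x \<otimes>\<^bsub>L\<^esub> y)"
    if c: "(Y1, c1) \<in> fibre x" "(Y2, c2) \<in> fibre y" and Z: "Z \<in> D" "Y1 \<union> Y2 \<subseteq> Z"
    for Y1 c1 Y2 c2 Z
  proof -
    interpret Z: group "G Z" using Z group_G by simp
    have *: "t Y1 Z c1 \<in> carrier (G Z)" "t Y2 Z c2 \<in> carrier (G Z)"
      using c Z by (auto simp: fibre_def t_closed)
    then have "u Z (t Y1 Z c1 \<otimes>\<^bsub>G Z\<^esub> t Y2 Z c2) = x \<otimes>\<^bsub>L\<^esub> y"
      using c Z by (auto simp: fibre_def u_t hom_mult[OF u_hom])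
    then show ?thesis using * Z by (simp add: dirlim_class_eq_fibre)
  qed
  \<comment> \<open>The product is a union over all choices of representatives and of an upper
    bound. By \<open>cl\<close> all members agree; one choice must still be exhibited, so that the
    union is not empty.\<close>
  obtain Y1 c1 Y2 c2 where c: "(Y1, c1) \<in> fibre x" "(Y2, c2) \<in> fibre y"
    using u_surj[OF x] u_surj[OF y] by (auto simp: fibre_def)
  moreover obtain Z where Z: "Z \<in> D" "Y1 \<union> Y2 \<subseteq> Z"
    using c directed by (fastforce simp: fibre_def)
  ultimately have "(\<Union>(Y1, c1)\<in>fibre x. \<Union>(Y2, c2)\<in>fibre y. \<Union>Z\<in>{Z\<in>D. Y1 \<union> Y2 \<subseteq> Z}.
      dirlim_class D G t Z (t Y1 Z c1 \<otimes>\<^bsub>G Z\<^esub> t Y2 Z c2)) = fibre (x \<otimes>\<^bsub>L\<^esub> y)"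
    (is "?U = _")
  proof (intro equalityI)
    show "?U \<subseteq> fibre (x \<otimes>\<^bsub>L\<^esub> y)" by (intro UN_least) (clarsimp simp: cl split: prod.splits)
    show "fibre (x \<otimes>\<^bsub>L\<^esub> y) \<subseteq> ?U"
      using c \<open>Z \<in> D\<close> \<open>Y1 \<union> Y2 \<subseteq> Z\<close> cl[OF c \<open>Z \<in> D\<close> \<open>Y1 \<union> Y2 \<subseteq> Z\<close>] by blast
  qed
  then show ?thesis by (simp add: dirlim_def)
qed

lemma dirlim_map_fibre:
  assumes "x \<in> carrier L" shows "dirlim_map u (fibre x) = x"
proof -
  have "(\<lambda>(Y, c). u Y c) ` fibre x = {x}"
    using u_surj[OF assms] by (auto simp: fibre_def image_iff)
  then show ?thesis by (simp add: dirlim_map_def)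
qed

lemma dirlim_map_class:
  "Y \<in> D \<Longrightarrow> c \<in> carrier (G Y) \<Longrightarrow> dirlim_map u (dirlim_class D G t Y c) = u Y c"
  by (simp add: dirlim_class_eq_fibre dirlim_map_fibre u_closed)

theorem dirlim_map_iso: "dirlim_map u \<in> iso (dirlim D G t) L"
proof (rule isoI)
  show "dirlim_map u \<in> hom (dirlim D G t) L"
    using monoid.m_closed[OF group.is_monoid[OF group_L]]
    by (auto intro!: homI simp: carrier_dirlim mult_dirlim dirlim_map_fibre)
  show "bij_betw (dirlim_map u) (carrier (dirlim D G t)) (carrier L)"
    unfolding carrier_dirlim by (rule bij_betw_byWitness[where f' = fibre]) (auto simp: dirlim_map_fibre)
qed

text \<open>\<open>uN\<close> is the colimit condition for the subgroups: what falls into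
  \<open>N\<close> in the limit falls into \<open>H Z\<close> at some stage \<open>Z\<close>. This
  is exactly \<open>u_ker\<close> for the quotients, while \<open>u_surj\<close> is inherited by
  choosing representatives. It serves both for boundaries inside cycles and for
  subcomplexes.\<close>

lemma cocone_Mod:
  assumes H: "\<And>Y. Y \<in> D \<Longrightarrow> subgroup (H Y) (G Y)" and N: "subgroup N L"
    and tH: "\<And>Y Z. Y \<in> D \<Longrightarrow> Z \<in> D \<Longrightarrow> Y \<subseteq> Z \<Longrightarrow> t Y Z ` H Y \<subseteq> H Z"
    and uH: "\<And>Y. Y \<in> D \<Longrightarrow> u Y ` H Y \<subseteq> N"
    and uN: "\<And>Y c. Y \<in> D \<Longrightarrow> c \<in> carrier (G Y) \<Longrightarrow> u Y c \<in> N \<Longrightarrow> \<exists>Z\<in>D. Y \<subseteq> Z \<and> t Y Z c \<in> H Z"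
  shows "directed_cocone D (\<lambda>Y. G Y Mod H Y) (\<lambda>Y Z. coset_map (G Z) (H Z) (t Y Z))
           (L Mod N) (\<lambda>Y. coset_map L N (u Y))"
proof -
  have tm: "coset_map (G Z) (H Z) (t Y Z) (H Y #>\<^bsub>G Y\<^esub> c) = H Z #>\<^bsub>G Z\<^esub> t Y Z c"
    if "Y \<in> D" "Z \<in> D" "Y \<subseteq> Z" "c \<in> carrier (G Y)" for Y Z c
    using that by (intro coset_map_r_coset group_G t_hom H tH)
  have um: "coset_map L N (u Y) (H Y #>\<^bsub>G Y\<^esub> c) = N #>\<^bsub>L\<^esub> u Y c"
    if "Y \<in> D" "c \<in> carrier (G Y)" for Y c
    using that by (intro coset_map_r_coset group_G group_L u_hom H N uH)
  show ?thesis
  proof (rule directed_cocone.intro)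
    fix Y c assume Y: "Y \<in> D" and c: "c \<in> carrier (G Y Mod H Y)"
      and eq: "coset_map L N (u Y) c = \<one>\<^bsub>L Mod N\<^esub>"
    obtain b where b: "b \<in> carrier (G Y)" "c = H Y #>\<^bsub>G Y\<^esub> b"
      using c by (auto simp: carrier_FactGroup)
    have "N #>\<^bsub>L\<^esub> u Y b = N" using eq b Y um by simp
    then have "u Y b \<in> N"
      using group.coset_join1[OF group_L] N b Y u_closed subgroup.subset by blast
    then obtain Z where Z: "Z \<in> D" "Y \<subseteq> Z" "t Y Z b \<in> H Z" using uN Y b by blast
    then have "H Z #>\<^bsub>G Z\<^esub> t Y Z b = H Z"
      using group.coset_join2[OF group_G] H t_closed Y b by blast
    then show "\<exists>Z\<in>D. Y \<subseteq> Z \<and> coset_map (G Z) (H Z) (t Y Z) c = \<one>\<^bsub>G Z Mod H Z\<^esub>"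
      using Z Y b tm by auto
  next
    fix x assume "x \<in> carrier (L Mod N)"
    then obtain z where z: "z \<in> carrier L" "x = N #>\<^bsub>L\<^esub> z" by (auto simp: carrier_FactGroup)
    then obtain Y c where "Y \<in> D" "c \<in> carrier (G Y)" "u Y c = z" using u_surj by blast
    then show "\<exists>Y\<in>D. \<exists>c\<in>carrier (G Y Mod H Y). coset_map L N (u Y) c = x"
      using z um by (auto simp: carrier_FactGroup)
  next
    fix Y assume Y: "Y \<in> D"
    show "comm_group (G Y Mod H Y)"
      using Y by (intro comm_group.abelian_FactGroup grp_G H)
    show "coset_map L N (u Y) \<in> hom (G Y Mod H Y) (L Mod N)"
      using Y by (intro coset_map_hom grp_G grp_L u_hom H N uH)
    fix Z assume Z: "Z \<in> D"
    show "\<exists>W\<in>D. Y \<union> Z \<subseteq> W" using Y Z by (rule directed)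
    assume YZ: "Y \<subseteq> Z"
    show "coset_map (G Z) (H Z) (t Y Z) \<in> hom (G Y Mod H Y) (G Z Mod H Z)"
      using Y Z YZ by (intro coset_map_hom grp_G t_hom H tH)
    fix c assume c: "c \<in> carrier (G Y Mod H Y)"
    show "coset_map L N (u Z) (coset_map (G Z) (H Z) (t Y Z) c) = coset_map L N (u Y) c"
      using c Y Z YZ by (auto simp: carrier_FactGroup tm um t_closed u_t)
  next
    fix Y Z W c assume "Y \<in> D" "Z \<in> D" "W \<in> D" "Y \<subseteq> Z" "Z \<subseteq> W" "c \<in> carrier (G Y Mod H Y)"
    moreover from this have "Y \<subseteq> W" by simp
    ultimately show "coset_map (G W) (H W) (t Z W) (coset_map (G Z) (H Z) (t Y Z) c) =
        coset_map (G W) (H W) (t Y W) c"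
      by (auto simp: carrier_FactGroup tm t_closed t_comp)
  next
    show "comm_group (L Mod N)" by (intro comm_group.abelian_FactGroup grp_L N)
  qed (rule ne)
qed

end

section \<open>Chain complexes and exactness of directed colimits\<close>

text \<open>As \<open>0 - 1 = 0\<close>, the map \<open>bd C 0\<close> is an endomorphism of
  \<open>grp C 0\<close>, and the last condition for \<open>k = 0\<close> says that it kills the
  image of \<open>bd C 1\<close>; thus degree 0 is no special case below. For singular chains
  \<open>bd C 0\<close> is zero by the definition of \<open>ld_boundary\<close>.\<close>

definition chain_complex :: "'a complex_of_groups \<Rightarrow> bool" where
  "chain_complex C \<longleftrightarrow>
     (\<forall>k. comm_group (grp C k) \<and> bd C k \<in> hom (grp C k) (grp C (k - 1)) \<and>
          (\<forall>x\<in>carrier (grp C (Suc k)). bd C k (bd C (Suc k) x) = \<one>\<^bsub>grp C (k - 1)\<^esub>))"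

definition cycles :: "'a complex_of_groups \<Rightarrow> nat \<Rightarrow> 'a set" where
  "cycles C n = kernel (grp C n) (grp C (n - 1)) (bd C n)"

lemma mem_cycles_iff: "z \<in> cycles C n \<longleftrightarrow> z \<in> carrier (grp C n) \<and> bd C n z = \<one>\<^bsub>grp C (n - 1)\<^esub>"
  by (simp add: cycles_def kernel_def)

lemma subgroup_cycles:
  assumes "chain_complex C" shows "subgroup (cycles C n) (grp C n)"
  unfolding cycles_def
  by (rule group_hom.subgroup_kernel, unfold group_hom_def group_hom_axioms_def)
     (use assms in \<open>auto simp: chain_complex_def comm_group.axioms\<close>)

lemma subgroup_boundaries:
  assumes "chain_complex C"
  shows "subgroup (boundaries C n) ((grp C n)\<lparr>carrier := cycles C n\<rparr>)"
proof (rule group.subgroup_incl)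
  show "group (grp C n)" using assms by (simp add: chain_complex_def comm_group.axioms)
  have "bd C (Suc n) \<in> hom (grp C (Suc n)) (grp C n)"
    using assms unfolding chain_complex_def by (metis diff_Suc_1)
  then have "group_hom (grp C (Suc n)) (grp C n) (bd C (Suc n))"
    using assms by (simp add: chain_complex_def comm_group.axioms group_hom_def group_hom_axioms_def)
  then show "subgroup (boundaries C n) (grp C n)"
    unfolding boundaries_def by (rule group_hom.img_is_subgroup)
  show "boundaries C n \<subseteq> cycles C n"
    using assms \<open>subgroup (boundaries C n) (grp C n)\<close>
    by (auto simp: mem_cycles_iff boundaries_def chain_complex_def dest: subgroup.mem_carrier)
qed (use assms subgroup_cycles in auto)

lemma comm_group_cycles:
  assumes "chain_complex C" shows "comm_group ((grp C n)\<lparr>carrier := cycles C n\<rparr>)"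
proof (rule group.group_comm_groupI)
  interpret comm_group "grp C n" using assms by (simp add: chain_complex_def)
  show "group ((grp C n)\<lparr>carrier := cycles C n\<rparr>)"
    using subgroup_cycles[OF assms] by (rule subgroup.subgroup_is_group) (rule is_group)
qed (use assms in \<open>simp add: chain_complex_def mem_cycles_iff comm_group.axioms comm_monoid.m_comm\<close>)

lemma homology_eq: "homology C n = (grp C n)\<lparr>carrier := cycles C n\<rparr> Mod boundaries C n"
  by (simp add: homology_def cycles_def)

text \<open>Cosets depend on the multiplication alone. Hence \<open>homology_map\<close>, which is
  written with the group of all chains, agrees with the map formed in the group of cycles, where
  \<open>cocone_Mod\<close> is applied.\<close>

lemma coset_map_carrier_update [simp]: "coset_map (G\<lparr>carrier := X\<rparr>) H f = coset_map G H f"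
  by (simp add: coset_map_def fun_eq_iff)

lemma hom_carrier_update:
  assumes "f \<in> hom G K" "X \<subseteq> carrier G" "f ` X \<subseteq> X'"
  shows "f \<in> hom (G\<lparr>carrier := X\<rparr>) (K\<lparr>carrier := X'\<rparr>)"
  using assms by (auto simp: hom_def subset_iff)

text \<open>\<open>cocone\<close> is assumed in every degree \<open>k\<close>: homology in degree
  \<open>n\<close> needs the kernel condition in degree \<open>n - 1\<close> to lift cycles and
  surjectivity in degree \<open>n + 1\<close> to lift bounding chains.\<close>

locale complex_cocone =
  fixes D :: "'m set set"
    and C :: "'m set \<Rightarrow> 'g complex_of_groups"
    and t :: "'m set \<Rightarrow> 'm set \<Rightarrow> nat \<Rightarrow> 'g \<Rightarrow> 'g"
    and L :: "'h complex_of_groups"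
    and u :: "'m set \<Rightarrow> nat \<Rightarrow> 'g \<Rightarrow> 'h"
  assumes complex_C: "Y \<in> D \<Longrightarrow> chain_complex (C Y)"
    and complex_L: "chain_complex L"
    and cocone: "directed_cocone D (\<lambda>Y. grp (C Y) k) (\<lambda>Y Z. t Y Z k) (grp L k) (\<lambda>Y. u Y k)"
    and t_bd: "Y \<in> D \<Longrightarrow> Z \<in> D \<Longrightarrow> Y \<subseteq> Z \<Longrightarrow> c \<in> carrier (grp (C Y) k) \<Longrightarrow>
                 bd (C Z) k (t Y Z k c) = t Y Z (k - 1) (bd (C Y) k c)"
    and u_bd: "Y \<in> D \<Longrightarrow> c \<in> carrier (grp (C Y) k) \<Longrightarrow>
                 bd L k (u Y k c) = u Y (k - 1) (bd (C Y) k c)"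
begin

lemma bd_closed: "Y \<in> D \<Longrightarrow> c \<in> carrier (grp (C Y) k) \<Longrightarrow> bd (C Y) k c \<in> carrier (grp (C Y) (k - 1))"
  using complex_C by (auto simp: chain_complex_def dest: hom_in_carrier)

lemma t_cycles:
  assumes "Y \<in> D" "Z \<in> D" "Y \<subseteq> Z" "c \<in> cycles (C Y) n"
  shows "t Y Z n c \<in> cycles (C Z) n"
  using assms directed_cocone.t_closed[OF cocone] directed_cocone.t_one[OF cocone]
  by (simp add: mem_cycles_iff t_bd)

lemma u_cycles:
  assumes "Y \<in> D" "c \<in> cycles (C Y) n" shows "u Y n c \<in> cycles L n"
  using assms directed_cocone.u_closed[OF cocone] directed_cocone.u_one[OF cocone]
  by (simp add: mem_cycles_iff u_bd)

text \<open>A cycle of \<open>L\<close> lifts to a chain of some \<open>Y\<close>, but not at once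
  to a cycle. The boundary of the lift dies in the limit, so by \<open>u_ker\<close> one degree
  lower it dies at some \<open>Z\<close>, and there the lift has become a cycle.\<close>

lemma cycles_cocone:
  "directed_cocone D (\<lambda>Y. (grp (C Y) n)\<lparr>carrier := cycles (C Y) n\<rparr>) (\<lambda>Y Z. t Y Z n)
     ((grp L n)\<lparr>carrier := cycles L n\<rparr>) (\<lambda>Y. u Y n)"
proof -
  interpret chains: directed_cocone D "\<lambda>Y. grp (C Y) n" "\<lambda>Y Z. t Y Z n" "grp L n" "\<lambda>Y. u Y n"
    by (rule cocone)
  interpret chains': directed_cocone D "\<lambda>Y. grp (C Y) (n - 1)" "\<lambda>Y Z. t Y Z (n - 1)" "grp L (n - 1)"
    "\<lambda>Y. u Y (n - 1)" by (rule cocone)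
  have cyc: "cycles K n \<subseteq> carrier (grp K n)" for K :: "'k complex_of_groups"
    by (auto simp: mem_cycles_iff)
  show ?thesis
  proof (rule directed_cocone.intro)
    fix x assume x: "x \<in> carrier ((grp L n)\<lparr>carrier := cycles L n\<rparr>)"
    then obtain Y c where Y: "Y \<in> D" and c: "c \<in> carrier (grp (C Y) n)" "u Y n c = x"
      using chains.u_surj[of x] by (auto simp: mem_cycles_iff)
    have "u Y (n - 1) (bd (C Y) n c) = \<one>\<^bsub>grp L (n - 1)\<^esub>"
      using x u_bd[OF Y c(1)] c(2) by (simp add: mem_cycles_iff)
    then obtain Z where Z: "Z \<in> D" "Y \<subseteq> Z" "t Y Z (n - 1) (bd (C Y) n c) = \<one>\<^bsub>grp (C Z) (n - 1)\<^esub>"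
      using chains'.u_ker Y c bd_closed by blast
    then have "t Y Z n c \<in> cycles (C Z) n"
      using Y c by (simp add: mem_cycles_iff chains.t_closed t_bd)
    then show "\<exists>Y\<in>D. \<exists>c\<in>carrier ((grp (C Y) n)\<lparr>carrier := cycles (C Y) n\<rparr>). u Y n c = x"
      using Z Y c chains.u_t[of Y Z c] by (intro bexI[of _ Z] bexI[of _ "t Y Z n c"]) simp_all
  qed (use cyc chains.ne chains.directed chains.t_hom chains.u_hom chains.u_ker t_cycles u_cycles
        in \<open>auto simp: mem_cycles_iff chains.t_comp chains.u_t comm_group_cycles complex_C complex_L
             intro!: hom_carrier_update\<close>)
qed

text \<open>If a cycle \<open>c\<close> of \<open>Y\<close> bounds in \<open>L\<close>, the bounding
  chain lifts to some \<open>b\<close> over a possibly different \<open>Y'\<close>. Then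
  \<open>c\<close> and the boundary of \<open>b\<close> agree in \<open>L\<close>, so by
  \<open>u_eq_iff\<close> they agree at a common \<open>Z\<close>, where \<open>c\<close> bounds.
  This is \<open>uN\<close> for boundaries.\<close>

lemma homology_cocone:
  "directed_cocone D (\<lambda>Y. homology (C Y) n) (\<lambda>Y Z. homology_map (C Z) n (t Y Z n))
     (homology L n) (\<lambda>Y. homology_map L n (u Y n))"
proof -
  interpret chains: directed_cocone D "\<lambda>Y. grp (C Y) n" "\<lambda>Y Z. t Y Z n" "grp L n" "\<lambda>Y. u Y n"
    by (rule cocone)
  interpret chains': directed_cocone D "\<lambda>Y. grp (C Y) (Suc n)" "\<lambda>Y Z. t Y Z (Suc n)" "grp L (Suc n)"
    "\<lambda>Y. u Y (Suc n)" by (rule cocone)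
  interpret cyc: directed_cocone D "\<lambda>Y. (grp (C Y) n)\<lparr>carrier := cycles (C Y) n\<rparr>" "\<lambda>Y Z. t Y Z n"
    "(grp L n)\<lparr>carrier := cycles L n\<rparr>" "\<lambda>Y. u Y n" by (rule cycles_cocone)
  have tb: "t Y Z n (bd (C Y) (Suc n) b) = bd (C Z) (Suc n) (t Y Z (Suc n) b)"
    if "Y \<in> D" "Z \<in> D" "Y \<subseteq> Z" "b \<in> carrier (grp (C Y) (Suc n))" for Y Z b
    using t_bd[of Y Z b "Suc n"] that by simp
  have ub: "u Y n (bd (C Y) (Suc n) b) = bd L (Suc n) (u Y (Suc n) b)"
    if "Y \<in> D" "b \<in> carrier (grp (C Y) (Suc n))" for Y b
    using u_bd[of Y b "Suc n"] that by simp
  have "directed_cocone D (\<lambda>Y. (grp (C Y) n)\<lparr>carrier := cycles (C Y) n\<rparr> Mod boundaries (C Y) n)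
     (\<lambda>Y Z. coset_map ((grp (C Z) n)\<lparr>carrier := cycles (C Z) n\<rparr>) (boundaries (C Z) n) (t Y Z n))
     ((grp L n)\<lparr>carrier := cycles L n\<rparr> Mod boundaries L n)
     (\<lambda>Y. coset_map ((grp L n)\<lparr>carrier := cycles L n\<rparr>) (boundaries L n) (u Y n))"
  proof (rule cyc.cocone_Mod)
    fix Y c assume Y: "Y \<in> D" and c: "c \<in> carrier ((grp (C Y) n)\<lparr>carrier := cycles (C Y) n\<rparr>)"
      and "u Y n c \<in> boundaries L n"
    then obtain x where "x \<in> carrier (grp L (Suc n))" "u Y n c = bd L (Suc n) x"
      by (auto simp: boundaries_def)
    then obtain Y' b where b: "Y' \<in> D" "b \<in> carrier (grp (C Y') (Suc n))"
      "u Y n c = u Y' n (bd (C Y') (Suc n) b)"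
      using chains'.u_surj ub by metis
    moreover have "c \<in> carrier (grp (C Y) n)" "bd (C Y') (Suc n) b \<in> carrier (grp (C Y') n)"
      using c b bd_closed[of Y' b "Suc n"] by (auto simp: mem_cycles_iff)
    ultimately obtain Z where Z: "Z \<in> D" "Y \<union> Y' \<subseteq> Z"
      "t Y Z n c = t Y' Z n (bd (C Y') (Suc n) b)"
      using chains.u_eq_iff Y by blast
    then show "\<exists>Z\<in>D. Y \<subseteq> Z \<and> t Y Z n c \<in> boundaries (C Z) n"
      using b tb chains'.t_closed by (auto simp: boundaries_def)
  qed (auto simp: subgroup_boundaries complex_C complex_L,
       auto simp: boundaries_def tb ub chains'.t_closed chains'.u_closed)
  then show ?thesis
    by (simp add: homology_eq homology_map_def[abs_def])
qed

end

section \<open>Quotients by subcomplexes\<close>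

text \<open>The assumption \<open>bd\<close> makes the induced boundary computable on
  representatives (\<open>m\<close>). A double boundary is then the coset of the unit, which is the
  subgroup itself and so the unit of the quotient.\<close>

lemma chain_complex_quotient:
  assumes C: "chain_complex C" and S: "\<And>k. subgroup (carrier (grp S k)) (grp C k)"
    and bd: "\<And>k. bd C k ` carrier (grp S k) \<subseteq> carrier (grp S (k - 1))"
  shows "chain_complex (quotient_complex C S)"
proof -
  have cg: "comm_group (grp C k)" and g: "group (grp C k)" for k
    using C by (auto simp: chain_complex_def comm_group.axioms)
  have h: "bd C k \<in> hom (grp C k) (grp C (k - 1))" for k using C by (simp add: chain_complex_def)
  have m: "coset_map (grp C (k - 1)) (carrier (grp S (k - 1))) (bd C k) (carrier (grp S k) #>\<^bsub>grp C k\<^esub> x)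
      = carrier (grp S (k - 1)) #>\<^bsub>grp C (k - 1)\<^esub> bd C k x" if "x \<in> carrier (grp C k)" for k x
    using that by (intro coset_map_r_coset g h S bd)
  have cc: "bd C (Suc k) x \<in> carrier (grp C k)" if "x \<in> carrier (grp C (Suc k))" for k x
    using h[of "Suc k"] that by (simp add: hom_in_carrier)
  have one: "carrier (grp S k) #>\<^bsub>grp C k\<^esub> \<one>\<^bsub>grp C k\<^esub> = carrier (grp S k)" for k
    using S subgroup.subset g by (metis group.coset_mult_one)
  have bb: "bd C k (bd C (Suc k) x) = \<one>\<^bsub>grp C (k - 1)\<^esub>" if "x \<in> carrier (grp C (Suc k))" for k x
    using C that by (simp add: chain_complex_def)
  show ?thesis
    unfolding chain_complex_def
  proof (intro allI conjI ballI)
    fix k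
    show "comm_group (grp (quotient_complex C S) k)"
      by (simp add: quotient_complex_def comm_group.abelian_FactGroup cg S)
    show "bd (quotient_complex C S) k \<in> hom (grp (quotient_complex C S) k) (grp (quotient_complex C S) (k - 1))"
      unfolding quotient_complex_def using coset_map_hom[OF cg cg h S S bd] by simp
    fix X assume "X \<in> carrier (grp (quotient_complex C S) (Suc k))"
    then obtain x where x: "x \<in> carrier (grp C (Suc k))" "X = carrier (grp S (Suc k)) #>\<^bsub>grp C (Suc k)\<^esub> x"
      by (auto simp: quotient_complex_def carrier_FactGroup)
    have "bd (quotient_complex C S) (Suc k) X = carrier (grp S k) #>\<^bsub>grp C k\<^esub> bd C (Suc k) x"
      using m[of x "Suc k"] x by (simp add: quotient_complex_def)
    then show "bd (quotient_complex C S) k (bd (quotient_complex C S) (Suc k) X)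
        = \<one>\<^bsub>grp (quotient_complex C S) (k - 1)\<^esub>"
      using m[OF cc[OF x(1)]] bb[OF x(1)] one by (simp add: quotient_complex_def)
  qed
qed

text \<open>In each degree this is \<open>cocone_Mod\<close>. What remains is compatibility with the
  boundaries, checked on representatives through the four computation rules \<open>bm\<close>,
  \<open>bL\<close>, \<open>tm\<close> and \<open>um\<close>.\<close>

lemma (in complex_cocone) quotient_cocone:
  assumes S: "\<And>Y k. Y \<in> D \<Longrightarrow> subgroup (carrier (grp (S Y) k)) (grp (C Y) k)"
    and bdS: "\<And>Y k. Y \<in> D \<Longrightarrow> bd (C Y) k ` carrier (grp (S Y) k) \<subseteq> carrier (grp (S Y) (k - 1))"
    and N: "\<And>k. subgroup (carrier (grp N k)) (grp L k)"
    and bdN: "\<And>k. bd L k ` carrier (grp N k) \<subseteq> carrier (grp N (k - 1))"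
    and tS: "\<And>Y Z k. Y \<in> D \<Longrightarrow> Z \<in> D \<Longrightarrow> Y \<subseteq> Z \<Longrightarrow> t Y Z k ` carrier (grp (S Y) k) \<subseteq> carrier (grp (S Z) k)"
    and uS: "\<And>Y k. Y \<in> D \<Longrightarrow> u Y k ` carrier (grp (S Y) k) \<subseteq> carrier (grp N k)"
    and uN: "\<And>Y k c. Y \<in> D \<Longrightarrow> c \<in> carrier (grp (C Y) k) \<Longrightarrow> u Y k c \<in> carrier (grp N k) \<Longrightarrow>
               \<exists>Z\<in>D. Y \<subseteq> Z \<and> t Y Z k c \<in> carrier (grp (S Z) k)"
  shows "complex_cocone D (\<lambda>Y. quotient_complex (C Y) (S Y))
           (\<lambda>Y Z k. coset_map (grp (C Z) k) (carrier (grp (S Z) k)) (t Y Z k))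
           (quotient_complex L N) (\<lambda>Y k. coset_map (grp L k) (carrier (grp N k)) (u Y k))"
proof (rule complex_cocone.intro)
  show "chain_complex (quotient_complex (C Y) (S Y))" if "Y \<in> D" for Y
    using that complex_C S bdS by (intro chain_complex_quotient)
  show "chain_complex (quotient_complex L N)"
    using complex_L N bdN by (intro chain_complex_quotient)
  have coc: "directed_cocone D (\<lambda>Y. grp (C Y) k) (\<lambda>Y Z. t Y Z k) (grp L k) (\<lambda>Y. u Y k)" for k
    by (rule cocone)
  show "directed_cocone D (\<lambda>Y. grp (quotient_complex (C Y) (S Y)) k)
     (\<lambda>Y Z. coset_map (grp (C Z) k) (carrier (grp (S Z) k)) (t Y Z k))
     (grp (quotient_complex L N) k) (\<lambda>Y. coset_map (grp L k) (carrier (grp N k)) (u Y k))" for k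
    using directed_cocone.cocone_Mod[OF coc[of k], of "\<lambda>Y. carrier (grp (S Y) k)" "carrier (grp N k)",
        OF S N tS uS uN]
    by (simp add: quotient_complex_def)
  have bh: "bd (C Y) k \<in> hom (grp (C Y) k) (grp (C Y) (k - 1))" if "Y \<in> D" for Y k
    using complex_C that by (simp add: chain_complex_def)
  have bm: "coset_map (grp (C Y) (k - 1)) (carrier (grp (S Y) (k - 1))) (bd (C Y) k)
        (carrier (grp (S Y) k) #>\<^bsub>grp (C Y) k\<^esub> c)
      = carrier (grp (S Y) (k - 1)) #>\<^bsub>grp (C Y) (k - 1)\<^esub> bd (C Y) k c"
    if "Y \<in> D" "c \<in> carrier (grp (C Y) k)" for Y k c
    using that by (intro coset_map_r_coset directed_cocone.group_G[OF cocone] bh S bdS)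
  have bL: "coset_map (grp L (k - 1)) (carrier (grp N (k - 1))) (bd L k)
        (carrier (grp N k) #>\<^bsub>grp L k\<^esub> x)
      = carrier (grp N (k - 1)) #>\<^bsub>grp L (k - 1)\<^esub> bd L k x"
    if "x \<in> carrier (grp L k)" for k x
    using that complex_L
    by (intro coset_map_r_coset directed_cocone.group_L[OF cocone] N bdN) (simp add: chain_complex_def)
  have tm: "coset_map (grp (C Z) k) (carrier (grp (S Z) k)) (t Y Z k)
        (carrier (grp (S Y) k) #>\<^bsub>grp (C Y) k\<^esub> c) = carrier (grp (S Z) k) #>\<^bsub>grp (C Z) k\<^esub> t Y Z k c"
    if "Y \<in> D" "Z \<in> D" "Y \<subseteq> Z" "c \<in> carrier (grp (C Y) k)" for Y Z k c
    using that by (intro coset_map_r_coset directed_cocone.group_G[OF cocone]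
        directed_cocone.t_hom[OF cocone] S tS)
  have um: "coset_map (grp L k) (carrier (grp N k)) (u Y k)
        (carrier (grp (S Y) k) #>\<^bsub>grp (C Y) k\<^esub> c) = carrier (grp N k) #>\<^bsub>grp L k\<^esub> u Y k c"
    if "Y \<in> D" "c \<in> carrier (grp (C Y) k)" for Y k c
    using that by (intro coset_map_r_coset directed_cocone.group_G[OF cocone]
        directed_cocone.group_L[OF cocone] directed_cocone.u_hom[OF cocone] S N uS)
  note cl = directed_cocone.t_closed[OF coc] directed_cocone.u_closed[OF coc]
  show "bd (quotient_complex (C Z) (S Z)) k
          (coset_map (grp (C Z) k) (carrier (grp (S Z) k)) (t Y Z k) c) =
        coset_map (grp (C Z) (k - 1)) (carrier (grp (S Z) (k - 1))) (t Y Z (k - 1))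
          (bd (quotient_complex (C Y) (S Y)) k c)"
    if "Y \<in> D" "Z \<in> D" "Y \<subseteq> Z" "c \<in> carrier (grp (quotient_complex (C Y) (S Y)) k)" for Y Z c k
    using that unfolding quotient_complex_def
    by (auto simp: carrier_FactGroup tm bm[simplified] bm cl bd_closed t_bd simp del: One_nat_def)
  show "bd (quotient_complex L N) k (coset_map (grp L k) (carrier (grp N k)) (u Y k) c) =
        coset_map (grp L (k - 1)) (carrier (grp N (k - 1))) (u Y (k - 1))
          (bd (quotient_complex (C Y) (S Y)) k c)"
    if "Y \<in> D" "c \<in> carrier (grp (quotient_complex (C Y) (S Y)) k)" for Y c k
    using that unfolding quotient_complex_def
    by (auto simp: carrier_FactGroup um bm bL cl bd_closed u_bd simp del: One_nat_def)
qed

section \<open>Definable sets and definable subspaces\<close>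

text \<open>Substitution is needed for two changes of coordinates: hiding the second block of a pair
  from a formula about the first block, and inserting a zero as the face maps do.\<close>

primrec subst_term :: "(nat \<Rightarrow> ('f, 'r) fo_term) \<Rightarrow> ('f, 'r) fo_term \<Rightarrow> ('f, 'r) fo_term" where
  "subst_term s (Var i) = s i"
| "subst_term s (Param a) = Param a"
| "subst_term s (Plus t u) = Plus (subst_term s t) (subst_term s u)"
| "subst_term s (Times t u) = Times (subst_term s t) (subst_term s u)"
| "subst_term s (Fun f ts) = Fun f (map (subst_term s) ts)"

lemma eval_subst_term [simp]: "eval_term R e (subst_term s t) = eval_term R (\<lambda>i. eval_term R e (s i)) t"
  by (induction t) (auto simp: comp_def cong: map_cong)

definition lift_subst :: "(nat \<Rightarrow> ('f, 'r) fo_term) \<Rightarrow> nat \<Rightarrow> ('f, 'r) fo_term" where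
  "lift_subst s = case_nat (Var 0) (\<lambda>i. subst_term (\<lambda>j. Var (Suc j)) (s i))"

lemma eval_lift_subst:
  "(\<lambda>i. eval_term R (case_nat a e) (lift_subst s i)) = case_nat a (\<lambda>i. eval_term R e (s i))"
  by (auto simp: lift_subst_def fun_eq_iff split: nat.split)

primrec subst_formula ::
  "('f, 'p, 'r) fo_formula \<Rightarrow> (nat \<Rightarrow> ('f, 'r) fo_term) \<Rightarrow> ('f, 'p, 'r) fo_formula" where
  "subst_formula (Eql t u) s = Eql (subst_term s t) (subst_term s u)"
| "subst_formula (Less t u) s = Less (subst_term s t) (subst_term s u)"
| "subst_formula (Rel p ts) s = Rel p (map (subst_term s) ts)"
| "subst_formula (Neg \<phi>) s = Neg (subst_formula \<phi> s)"
| "subst_formula (Conj \<phi> \<psi>) s = Conj (subst_formula \<phi> s) (subst_formula \<psi> s)"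
| "subst_formula (Exists \<phi>) s = Exists (subst_formula \<phi> (lift_subst s))"

lemma sat_subst_formula [simp]:
  "sat R e (subst_formula \<phi> s) \<longleftrightarrow> sat R (\<lambda>i. eval_term R e (s i)) \<phi>"
  by (induction \<phi> arbitrary: e s) (auto simp: comp_def eval_lift_subst)

text \<open>Pushing \<open>m\<close> values onto an environment \<open>y\<close> produces exactly the environment \<open>(x, y)\<close>, so projections
  along the first \<open>m\<close> coordinates are iterated quantifiers.\<close>

lemma sat_Exists_funpow:
  "sat R y ((Exists ^^ m) \<phi>) \<longleftrightarrow> (\<exists>x. sat R (Rn_pair m x y) \<phi>)"
proof (induction m arbitrary: \<phi>)
  case 0
  then show ?case by (simp add: Rn_pair_def)
next
  case (Suc m)
  have push: "case_nat a (Rn_pair m x y) = Rn_pair (Suc m) (case_nat a x) y" for a x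
    by (auto simp: Rn_pair_def fun_eq_iff split: nat.split)
  have pop: "Rn_pair (Suc m) z y = case_nat (z 0) (Rn_pair m (\<lambda>i. z (Suc i)) y)" for z
    by (auto simp: Rn_pair_def fun_eq_iff split: nat.split)
  \<comment> \<open>The innermost quantifier is moved into the formula, so that the induction
    hypothesis applies to \<open>Exists \<phi>\<close>. The value it binds is pushed last and
    becomes coordinate 0; \<open>push\<close> and \<open>pop\<close> account for this shift.\<close>
  have "sat R y ((Exists ^^ Suc m) \<phi>) \<longleftrightarrow> (\<exists>x a. sat R (case_nat a (Rn_pair m x y)) \<phi>)"
    by (simp add: funpow_swap1 Suc.IH)
  also have "\<dots> \<longleftrightarrow> (\<exists>z. sat R (Rn_pair (Suc m) z y) \<phi>)"
    unfolding push using pop push by metis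
  finally show ?case .
qed

lemma definable_Rn: "definable R n (Rn n)"
  unfolding definable_def by (rule exI[of _ "Eql (Var 0) (Var 0)"]) auto

lemma definable_empty: "definable R n {}"
  unfolding definable_def by (rule exI[of _ "Neg (Eql (Var 0) (Var 0))"]) auto

lemma definable_subset_Rn: "definable R n A \<Longrightarrow> A \<subseteq> Rn n"
  by (auto simp: definable_def)

lemma definable_Un:
  assumes "definable R n A" "definable R n B" shows "definable R n (A \<union> B)"
proof -
  obtain \<phi> \<psi> where "A = {x \<in> Rn n. sat R x \<phi>}" "B = {x \<in> Rn n. sat R x \<psi>}"
    using assms by (auto simp: definable_def)
  then have "A \<union> B = {x \<in> Rn n. sat R x (Neg (Conj (Neg \<phi>) (Neg \<psi>)))}" by auto
  then show ?thesis unfolding definable_def by blast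
qed

lemma definable_Union:
  "finite J \<Longrightarrow> (\<And>j. j \<in> J \<Longrightarrow> definable R n (A j)) \<Longrightarrow> definable R n (\<Union>j\<in>J. A j)"
  by (induction J rule: finite_induct) (auto intro: definable_empty definable_Un)

lemma definable_image:
  assumes A: "definable R m A" and G: "definable R (m + n) G"
  shows "definable R n {y \<in> Rn n. \<exists>x\<in>A. Rn_pair m x y \<in> G}"
proof -
  obtain \<phi> where \<phi>: "A = {x \<in> Rn m. sat R x \<phi>}" using A by (auto simp: definable_def)
  obtain \<psi> where \<psi>: "G = {x \<in> Rn (m + n). sat R x \<psi>}" using G by (auto simp: definable_def)
  \<comment> \<open>\<open>\<phi>\<close> may mention variables from \<open>m\<close> on. They mean
    0 at a point of \<open>A\<close>, but in the environment \<open>(x, y)\<close> they would read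
    \<open>y\<close>; \<open>?s\<close> resets them to 0.\<close>
  let ?s = "\<lambda>i. if i < m then Var i else Param 0"
  have tr: "(\<lambda>i. eval_term R (Rn_pair m x y) (?s i)) = (\<lambda>i. if i < m then x i else 0)" for x y
    by (auto simp: Rn_pair_def)
  have "{y \<in> Rn n. \<exists>x\<in>A. Rn_pair m x y \<in> G}
      = {y \<in> Rn n. sat R y ((Exists ^^ m) (Conj (subst_formula \<phi> ?s) \<psi>))}"
  proof (intro Collect_cong conj_cong refl)
    fix y :: "nat \<Rightarrow> 'c" assume y: "y \<in> Rn n"
    show "(\<exists>x\<in>A. Rn_pair m x y \<in> G) \<longleftrightarrow> sat R y ((Exists ^^ m) (Conj (subst_formula \<phi> ?s) \<psi>))"
    proof
      assume "\<exists>x\<in>A. Rn_pair m x y \<in> G"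
      then obtain x where x: "x \<in> A" "Rn_pair m x y \<in> G" by blast
      have "(\<lambda>i. if i < m then x i else 0) = x" using x \<phi> by (auto simp: Rn_def fun_eq_iff)
      then show "sat R y ((Exists ^^ m) (Conj (subst_formula \<phi> ?s) \<psi>))"
        unfolding sat_Exists_funpow using x \<phi> \<psi> tr by (intro exI[of _ x]) simp
    next
      assume "sat R y ((Exists ^^ m) (Conj (subst_formula \<phi> ?s) \<psi>))"
      then obtain x where x: "sat R (\<lambda>i. if i < m then x i else 0) \<phi>" "sat R (Rn_pair m x y) \<psi>"
        unfolding sat_Exists_funpow using tr by auto
      \<comment> \<open>The quantifiers only yield an arbitrary function \<open>x\<close>. Its first
        \<open>m\<close> values are all that the pair sees, so cutting it off gives the required
        point of \<open>Rn m\<close>.\<close>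
      let ?x = "\<lambda>i. if i < m then x i else 0"
      have "Rn_pair m ?x y = Rn_pair m x y" by (auto simp: Rn_pair_def)
      moreover have "Rn_pair m ?x y \<in> Rn (m + n)" using y by (auto simp: Rn_pair_def Rn_def)
      ultimately have "Rn_pair m ?x y \<in> G" "?x \<in> A" using x \<phi> \<psi> by (auto simp: Rn_def)
      then show "\<exists>x\<in>A. Rn_pair m x y \<in> G" by blast
    qed
  qed
  then show ?thesis unfolding definable_def by blast
qed

lemma Rn_pair_eq_iff:
  assumes "x \<in> Rn m" "x' \<in> Rn m"
  shows "Rn_pair m x y = Rn_pair m x' y' \<longleftrightarrow> x = x' \<and> y = y'"
proof
  assume eq: "Rn_pair m x y = Rn_pair m x' y'"
  have "x i = x' i" for i
    using fun_cong[OF eq, of i] assms by (cases "i < m") (auto simp: Rn_pair_def Rn_def)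
  moreover have "y i = y' i" for i
    using fun_cong[OF eq, of "m + i"] by (simp add: Rn_pair_def)
  ultimately show "x = x' \<and> y = y'" by auto
qed auto

text \<open>The image is the projection of the part of the graph over \<open>A\<close>. A pair
  determines its first block, so lying on the graph already forces \<open>x\<close> into
  \<open>X\<close>.\<close>

lemma definable_graph_image:
  assumes A: "definable R m A" and G: "definable R (m + n) {Rn_pair m x (f x) | x. x \<in> X}"
    and X: "X \<subseteq> Rn m" and f: "f ` X \<subseteq> Rn n"
  shows "definable R n (f ` (A \<inter> X))"
proof -
  have "f ` (A \<inter> X) = {y \<in> Rn n. \<exists>x\<in>A. Rn_pair m x y \<in> {Rn_pair m x (f x) | x. x \<in> X}}"
    using definable_subset_Rn[OF A] X f by (auto simp: Rn_pair_eq_iff subset_iff)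
  then show ?thesis using definable_image[OF A G] by simp
qed

text \<open>Inserting a zero at position \<open>j\<close> is a substitution of variables and of the
  parameter 0, so this preimage is definable without a quantifier.\<close>

lemma definable_simplical_face_vimage:
  assumes G: "definable R (Suc n) G" and j: "j \<le> n"
  shows "definable R n {e \<in> Rn n. simplical_face j e \<in> G}"
proof -
  obtain \<phi> where \<phi>: "G = {x \<in> Rn (Suc n). sat R x \<phi>}" using G by (auto simp: definable_def)
  let ?s = "\<lambda>i. if i < j then Var i else if i = j then Param 0 else Var (i - 1)"
  have "(\<lambda>i. eval_term R e (?s i)) = simplical_face j e" for e
    by (auto simp: simplical_face_def)
  moreover have "simplical_face j e \<in> Rn (Suc n)" if "e \<in> Rn n" for e :: "nat \<Rightarrow> 'c"
    using that j by (auto simp: Rn_def simplical_face_def)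
  ultimately have "{e \<in> Rn n. simplical_face j e \<in> G} = {e \<in> Rn n. sat R e (subst_formula \<phi> ?s)}"
    unfolding \<phi> by auto
  then show ?thesis unfolding definable_def by blast
qed

section \<open>Definable subspaces of an atlas\<close>

lemma coord_in_Rn:
  assumes "locally_definable_space R M" "i \<in> index M" "x \<in> chart M i"
  shows "coord M i x \<in> Rn (chart_dim M i)"
  using assms definable_subset_Rn unfolding locally_definable_space_def coord_image_def by blast

lemma definable_subspace_subset:
  "locally_definable_space R M \<Longrightarrow> definable_subspace R M Y \<Longrightarrow> Y \<subseteq> points M"
  unfolding locally_definable_space_def definable_subspace_def by blast

text \<open>By definition \<open>Y\<close> is only known to be definable in the finitely many charts that cover it; the
  transition maps carry this over to the others.\<close>

lemma definable_subspace_chart: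
  assumes M: "locally_definable_space R M" and Y: "definable_subspace R M Y" and i: "i \<in> index M"
  shows "definable R (chart_dim M i) (coord M i ` (Y \<inter> chart M i))"
proof -
  obtain J where J: "finite J" "J \<subseteq> index M" "Y \<subseteq> (\<Union>j\<in>J. chart M j)"
    "\<And>j. j \<in> J \<Longrightarrow> definable R (chart_dim M j) (coord M j ` (Y \<inter> chart M j))"
    using Y by (auto simp: definable_subspace_def)
  have "definable R (chart_dim M i) (coord M i ` (Y \<inter> chart M j \<inter> chart M i))" if j: "j \<in> J" for j
  proof -
    let ?X = "coord M j ` (chart M j \<inter> chart M i)"
    let ?f = "coord M i \<circ> inv_into (chart M j) (coord M j)"
    have jM: "j \<in> index M" using J j by auto
    have inj: "inj_on (coord M j) (chart M j)" using M jM by (simp add: locally_definable_space_def)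
    have G: "definable R (chart_dim M j + chart_dim M i) {Rn_pair (chart_dim M j) x (?f x) | x. x \<in> ?X}"
      using M i jM unfolding locally_definable_space_def definable_map_def by blast
    have X: "?X \<subseteq> Rn (chart_dim M j)" using coord_in_Rn[OF M jM] by auto
    have f: "?f (coord M j x) = coord M i x" if "x \<in> chart M j" for x
      using that inj by simp
    have "?f ` ?X \<subseteq> Rn (chart_dim M i)"
      using f coord_in_Rn[OF M i] by auto
    then have "definable R (chart_dim M i) (?f ` (coord M j ` (Y \<inter> chart M j) \<inter> ?X))"
      using definable_graph_image[OF J(4)[OF j] G X] by simp
    moreover have "coord M j ` (Y \<inter> chart M j) \<inter> ?X = coord M j ` (Y \<inter> chart M j \<inter> chart M i)"
      using inj by (auto simp: inj_on_def)
    moreover have "?f ` coord M j ` (Y \<inter> chart M j \<inter> chart M i) = coord M i ` (Y \<inter> chart M j \<inter> chart M i)"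
      using f by (force simp: image_image)
    ultimately show ?thesis by simp
  qed
  then have "definable R (chart_dim M i) (\<Union>j\<in>J. coord M i ` (Y \<inter> chart M j \<inter> chart M i))"
    using J by (intro definable_Union)
  moreover have "(\<Union>j\<in>J. coord M i ` (Y \<inter> chart M j \<inter> chart M i)) = coord M i ` (Y \<inter> chart M i)"
    using J(3) by blast
  ultimately show ?thesis by simp
qed

lemma definable_subspace_empty: "definable_subspace R M {}"
  unfolding definable_subspace_def by (rule exI[of _ "{}"]) simp

text \<open>The charts covering \<open>Y\<close> may differ from those covering \<open>Z\<close>.
  The union has to be tested in both families, so each set must be definable in the charts chosen
  for the other; this is what \<open>definable_subspace_chart\<close> supplies.\<close>

lemma definable_subspace_Un:
  assumes M: "locally_definable_space R M"
    and Y: "definable_subspace R M Y" and Z: "definable_subspace R M Z"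
  shows "definable_subspace R M (Y \<union> Z)"
proof -
  obtain J K where J: "finite J" "J \<subseteq> index M" "Y \<subseteq> (\<Union>j\<in>J. chart M j)"
    and K: "finite K" "K \<subseteq> index M" "Z \<subseteq> (\<Union>j\<in>K. chart M j)"
    using Y Z by (auto simp: definable_subspace_def)
  have "definable R (chart_dim M i) (coord M i ` ((Y \<union> Z) \<inter> chart M i))" if "i \<in> index M" for i
    using definable_Un[OF definable_subspace_chart[OF M Y that] definable_subspace_chart[OF M Z that]]
    by (simp add: Int_Un_distrib2 image_Un)
  then show ?thesis
    unfolding definable_subspace_def using J K by (intro exI[of _ "J \<union> K"]) auto
qed

lemma definable_subspace_Union:
  assumes "locally_definable_space R M" "finite \<Y>" "\<And>Y. Y \<in> \<Y> \<Longrightarrow> definable_subspace R M Y"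
  shows "definable_subspace R M (\<Union>\<Y>)"
  using assms(2,3)
  by (induction \<Y> rule: finite_induct)
     (auto intro: definable_subspace_empty definable_subspace_Un assms(1))

section \<open>Face inclusions of the standard simplex\<close>

lemma simplical_face_in_simplex_set:
  fixes x :: "nat \<Rightarrow> 'r::linordered_field"
  assumes x: "x \<in> simplex_set k" and j: "j \<le> Suc k"
  shows "simplical_face j x \<in> simplex_set (Suc k)"
proof -
  have "(\<Sum>i\<le>Suc k. simplical_face j x i) = (\<Sum>i\<le>k. x i)"
    using sum.zero_middle[of "Suc k" j x x] j by (simp add: simplical_face_def cong: if_cong)
  then show ?thesis
    using x j by (auto simp: simplex_set_def Rn_def simplical_face_def)
qed

text \<open>Every coordinate of \<open>x\<close> reappears in its face at the same or the next
  index, and the inserted zero does not change the sum. The converse direction is used to recognise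
  which points of the graph of a simplex come from the graph of its face.\<close>

lemma simplical_face_in_simplex_set_iff:
  fixes x :: "nat \<Rightarrow> 'r::linordered_field"
  assumes j: "j \<le> Suc k"
  shows "simplical_face j x \<in> simplex_set (Suc k) \<longleftrightarrow> x \<in> simplex_set k"
proof
  assume S: "simplical_face j x \<in> simplex_set (Suc k)"
  have x: "x i = simplical_face j x (if i < j then i else Suc i)" for i
    by (simp add: simplical_face_def)
  have "(\<Sum>i\<le>Suc k. simplical_face j x i) = (\<Sum>i\<le>k. x i)"
    using sum.zero_middle[of "Suc k" j x x] j by (simp add: simplical_face_def cong: if_cong)
  moreover have "x i = 0" if "Suc k \<le> i" for i
    using S that j by (subst x) (auto simp: simplex_set_def Rn_def)
  moreover have "0 \<le> x i" for i
    using S by (subst x) (auto simp: simplex_set_def)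
  ultimately show "x \<in> simplex_set k" using S by (simp add: simplex_set_def Rn_def)
qed (rule simplical_face_in_simplex_set[OF _ j])

lemma continuous_map_simplical_face:
  "continuous_map (product_topology (\<lambda>_. euclidean) UNIV) (product_topology (\<lambda>_. euclidean) UNIV)
     (simplical_face j :: (nat \<Rightarrow> 'r::{comm_monoid_add,topological_space}) \<Rightarrow> _)"
  unfolding continuous_map_componentwise_UNIV
proof
  fix i
  show "continuous_map (product_topology (\<lambda>_. euclidean) UNIV) euclidean
      (\<lambda>x. simplical_face j x i :: 'r)"
    by (auto simp: simplical_face_def intro: continuous_map_product_projection)
qed

section \<open>Singular simplices and chains\<close>

lemma simplex_set_subset_Rn: "simplex_set k \<subseteq> Rn (Suc k)"
  by (auto simp: simplex_set_def)

lemma subtopology_Rn_top_simplex_set: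
  "subtopology (Rn_top (Suc k)) (simplex_set k)
     = subtopology (product_topology (\<lambda>_. euclidean) UNIV)
         (simplex_set k :: (nat \<Rightarrow> 'r::{linordered_field,linorder_topology}) set)"
  using simplex_set_subset_Rn[of k, where 'a='r]
  by (simp add: Rn_top_def subtopology_subtopology inf_absorb2)

lemma ld_topology_simplex_space:
  "ld_topology (simplex_space k)
     = subtopology (product_topology (\<lambda>_. euclidean) UNIV)
         (simplex_set k :: (nat \<Rightarrow> 'r::{linordered_field,linorder_topology}) set)" (is "?L = ?R")
proof (rule topology_eq[THEN iffD2], rule allI)
  fix U
  have "openin ?L U \<longleftrightarrow> U \<subseteq> simplex_set k \<and>
      openin (subtopology (Rn_top (Suc k)) (simplex_set k)) (U \<inter> simplex_set k)"
    by (subst openin_ld_topology) (simp_all add: simplex_space_def coord_image_def)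
  then show "openin ?L U \<longleftrightarrow> openin ?R U"
    unfolding subtopology_Rn_top_simplex_set
    by (metis inf.absorb1 openin_imp_subset)
qed

text \<open>The simplex has a single chart, with the identity as coordinate map and dimension
  \<open>Suc k\<close> (barycentric coordinates). So the quantifier over source charts disappears
  and the source topology is that of the product.\<close>

lemma ld_simplices_iff:
  fixes M :: "('i, 'm, 'r::{linordered_field,linorder_topology}) atlas"
  shows "\<sigma> \<in> ld_simplices R M k \<longleftrightarrow>
     \<sigma> \<in> extensional (simplex_set k) \<and> \<sigma> \<in> simplex_set k \<rightarrow> points M \<and>
     definable_subspace R M (\<sigma> ` simplex_set k) \<and>
     continuous_map (subtopology (product_topology (\<lambda>_. euclidean) UNIV) (simplex_set k)) (ld_topology M) \<sigma> \<and>
     (\<forall>j\<in>index M. definable R (Suc k + chart_dim M j)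
        {Rn_pair (Suc k) x (coord M j (\<sigma> x)) | x. x \<in> simplex_set k \<and> \<sigma> x \<in> chart M j})"
  unfolding ld_simplices_def ld_map_def ld_topology_simplex_space
  by (auto simp: simplex_space_def subtopology_subtopology)

text \<open>A set open in the subspace is described chart by chart by open sets \<open>W\<close> of
  the coordinate spaces, whereas the trace topology asks for one open set of \<open>M\<close>. Each
  \<open>W\<close> is pulled back along \<open>coord M i\<close> to a set open in the chart, hence
  in \<open>M\<close> since charts are open; the union of these pullbacks has the right trace on
  \<open>Y\<close>.\<close>

lemma ld_topology_subspace:
  assumes M: "locally_definable_space R M" and Y: "Y \<subseteq> points M"
  shows "ld_topology (ld_subspace M Y) = subtopology (ld_topology M) Y"
proof (rule topology_eq[THEN iffD2], rule allI)
  fix U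
  let ?T = "\<lambda>i. Rn_top (chart_dim M i)"
  have inj: "inj_on (coord M i) (chart M i)" if "i \<in> index M" for i
    using M that by (simp add: locally_definable_space_def)
  have sub: "coord_image (ld_subspace M Y) i = coord M i ` (chart M i \<inter> Y)" for i
    by (simp add: ld_subspace_def coord_image_def)
  have opn: "openin (ld_topology (ld_subspace M Y)) U \<longleftrightarrow> U \<subseteq> Y \<and>
      (\<forall>i\<in>index M. openin (subtopology (?T i) (coord M i ` (chart M i \<inter> Y))) (coord M i ` (U \<inter> (chart M i \<inter> Y))))"
    using inj by (subst openin_ld_topology)
      (auto simp: ld_subspace_def coord_image_def intro: inj_on_subset)
  show "openin (ld_topology (ld_subspace M Y)) U \<longleftrightarrow> openin (subtopology (ld_topology M) Y) U"
  proof
    assume "openin (subtopology (ld_topology M) Y) U"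
    then obtain V where V: "openin (ld_topology M) V" "U = V \<inter> Y"
      by (auto simp: openin_subtopology)
    have "openin (subtopology (?T i) (coord M i ` (chart M i \<inter> Y))) (coord M i ` (U \<inter> (chart M i \<inter> Y)))"
      if i: "i \<in> index M" for i
    proof -
      have "openin (subtopology (?T i) (coord_image M i)) (coord M i ` (V \<inter> chart M i))"
        using V i openin_ld_topology[OF inj] by blast
      then obtain W where W: "openin (?T i) W" "coord M i ` (V \<inter> chart M i) = W \<inter> coord M i ` chart M i"
        by (auto simp: openin_subtopology coord_image_def)
      have "coord M i ` (U \<inter> (chart M i \<inter> Y)) = coord M i ` (V \<inter> chart M i) \<inter> coord M i ` (chart M i \<inter> Y)"
        using inj[OF i] V by (auto simp: inj_on_def)
      also have "\<dots> = W \<inter> coord M i ` (chart M i \<inter> Y)" using W by blast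
      finally show ?thesis using W by (auto simp: openin_subtopology)
    qed
    then show "openin (ld_topology (ld_subspace M Y)) U" using opn V by blast
  next
    assume U: "openin (ld_topology (ld_subspace M Y)) U"
    then have UY: "U \<subseteq> Y" using opn by blast
    have "\<exists>V. openin (ld_topology M) V \<and> V \<inter> Y = U \<inter> chart M i" if i: "i \<in> index M" for i
    proof -
      obtain W where W: "openin (?T i) W"
        "coord M i ` (U \<inter> (chart M i \<inter> Y)) = W \<inter> coord M i ` (chart M i \<inter> Y)"
        using U opn i by (auto simp: openin_subtopology)
      have ch: "openin (ld_topology M) (chart M i)" by (rule openin_ld_topology_chart[OF M i])
      have "continuous_map (subtopology (ld_topology M) (chart M i)) (?T i) (coord M i)"
        using homeomorphic_imp_continuous_map[OF homeomorphic_map_coord[OF M i]]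
        by (simp add: continuous_map_in_subtopology)
      then have "openin (subtopology (ld_topology M) (chart M i))
          {x \<in> topspace (subtopology (ld_topology M) (chart M i)). coord M i x \<in> W}"
        using W(1) by (rule openin_continuous_map_preimage)
      then have "openin (ld_topology M) {x \<in> chart M i. coord M i x \<in> W}"
        using ch openin_subset[OF ch] by (simp add: openin_open_subtopology inf_absorb2)
      moreover have "{x \<in> chart M i. coord M i x \<in> W} \<inter> Y = U \<inter> chart M i"
      proof (intro equalityI subsetI)
        fix x assume x: "x \<in> {x \<in> chart M i. coord M i x \<in> W} \<inter> Y"
        then have "coord M i x \<in> coord M i ` (U \<inter> (chart M i \<inter> Y))" using W(2) by auto
        then show "x \<in> U \<inter> chart M i" using inj[OF i] x by (auto simp: inj_on_def)
      next
        fix x assume x: "x \<in> U \<inter> chart M i"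
        then have "coord M i x \<in> W" using W(2) UY by blast
        then show "x \<in> {x \<in> chart M i. coord M i x \<in> W} \<inter> Y" using x UY by auto
      qed
      ultimately show ?thesis by blast
    qed
    then obtain V where V: "\<And>i. i \<in> index M \<Longrightarrow> openin (ld_topology M) (V i) \<and> V i \<inter> Y = U \<inter> chart M i"
      by metis
    have "U \<subseteq> (\<Union>i\<in>index M. chart M i)" using UY Y M by (auto simp: locally_definable_space_def)
    then have "U = (\<Union>i\<in>index M. V i) \<inter> Y" using V by blast
    moreover have "openin (ld_topology M) (\<Union>i\<in>index M. V i)" using V by blast
    ultimately show "openin (subtopology (ld_topology M) Y) U" by (auto simp: openin_subtopology)
  qed
qed

lemma ld_subspace_subspace: "Z \<subseteq> Y \<Longrightarrow> ld_subspace (ld_subspace M Y) Z = ld_subspace M Z"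
  by (simp add: ld_subspace_def Int_assoc inf_absorb2)

lemma definable_subspace_ld_subspace:
  assumes "B \<subseteq> Y"
  shows "definable_subspace R (ld_subspace M Y) B \<longleftrightarrow> definable_subspace R M B"
proof -
  have "B \<inter> (chart M j \<inter> Y) = B \<inter> chart M j" for j using assms by auto
  moreover have "B \<subseteq> (\<Union>j\<in>J. chart M j \<inter> Y) \<longleftrightarrow> B \<subseteq> (\<Union>j\<in>J. chart M j)" for J using assms by auto
  ultimately show ?thesis by (simp add: definable_subspace_def ld_subspace_def)
qed

text \<open>This makes chains of a subspace literally chains of \<open>M\<close>, as all simplices
  are extensional functions into the same type. If the image lies in \<open>Y\<close>, cutting the
  charts down to \<open>Y\<close> changes neither the graphs nor the covering charts, and continuity
  is unaffected by \<open>ld_topology_subspace\<close>. It is applied to definable \<open>Y\<close>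
  and also to \<open>A\<close> and \<open>A \<inter> Y\<close>.\<close>

lemma ld_simplices_subspace:
  fixes R :: "('f, 'p, 'c::{linordered_field,linorder_topology}) expansion"
    and M :: "('d, 'e, 'c) atlas"
  assumes M: "locally_definable_space R M" and Y: "Y \<subseteq> points M"
  shows "ld_simplices R (ld_subspace M Y) k = {\<sigma> \<in> ld_simplices R M k. \<sigma> ` simplex_set k \<subseteq> Y}"
proof (rule Set.set_eqI)
  fix \<sigma> :: "(nat \<Rightarrow> 'c) \<Rightarrow> 'e"
  show "\<sigma> \<in> ld_simplices R (ld_subspace M Y) k \<longleftrightarrow> \<sigma> \<in> {\<sigma> \<in> ld_simplices R M k. \<sigma> ` simplex_set k \<subseteq> Y}"
  proof (cases "\<sigma> ` simplex_set k \<subseteq> Y")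
    case True
    have sel: "points (ld_subspace M Y) = Y" "index (ld_subspace M Y) = index M"
      "chart_dim (ld_subspace M Y) = chart_dim M" "coord (ld_subspace M Y) = coord M"
      "chart (ld_subspace M Y) j = chart M j \<inter> Y" for j
      by (simp_all add: ld_subspace_def)
    have "x \<in> simplex_set k \<and> \<sigma> x \<in> chart M j \<inter> Y \<longleftrightarrow> x \<in> simplex_set k \<and> \<sigma> x \<in> chart M j" for x j
      using True by auto
    moreover have "\<sigma> \<in> simplex_set k \<rightarrow> Y" "\<sigma> \<in> simplex_set k \<rightarrow> points M" using True Y by auto
    moreover have "topspace (subtopology (product_topology (\<lambda>_. euclidean) UNIV) (simplex_set k))
        = (simplex_set k :: (nat \<Rightarrow> 'c) set)" by simp
    ultimately show ?thesis
      using True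
      by (simp add: ld_simplices_iff ld_topology_subspace[OF M Y] definable_subspace_ld_subspace sel
          continuous_map_in_subtopology del: topspace_subtopology)
  next
    case False
    then have "\<not> \<sigma> \<in> simplex_set k \<rightarrow> points (ld_subspace M Y)" by (auto simp: ld_subspace_def)
    then show ?thesis using False by (simp add: ld_simplices_iff)
  qed
qed

text \<open>Continuity comes from composition, and the graph of a face is the preimage of the graph
  of \<open>\<sigma>\<close> under insertion of a zero. The image needs its own argument, as a
  subset of a definable subspace may fail to be definable.\<close>

lemma ld_face_simplex:
  fixes M :: "('i, 'm, 'r::{linordered_field,linorder_topology}) atlas"
  assumes M: "locally_definable_space R M" and \<sigma>: "\<sigma> \<in> ld_simplices R M (Suc k)" and j: "j \<le> Suc k"
  shows "ld_face (Suc k) j \<sigma> \<in> ld_simplices R M k"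
proof -
  let ?\<tau> = "ld_face (Suc k) j \<sigma>"
  let ?P = "product_topology (\<lambda>_. euclidean) UNIV :: (nat \<Rightarrow> 'r) topology"
  have \<tau>: "?\<tau> x = \<sigma> (simplical_face j x)" if "x \<in> simplex_set k" for x
    using that by (simp add: ld_face_def)
  note face = simplical_face_in_simplex_set[OF _ j]
  have img: "?\<tau> ` simplex_set k \<subseteq> \<sigma> ` simplex_set (Suc k)"
    using \<tau> face by auto
  have "continuous_map (subtopology ?P (simplex_set k)) (subtopology ?P (simplex_set (Suc k))) (simplical_face j)"
    using continuous_map_simplical_face face
    by (auto simp: continuous_map_in_subtopology intro: continuous_map_from_subtopology)
  then have "continuous_map (subtopology ?P (simplex_set k)) (ld_topology M) (\<sigma> \<circ> simplical_face j)"
    using \<sigma> by (auto simp: ld_simplices_iff intro: continuous_map_compose)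
  then have cont: "continuous_map (subtopology ?P (simplex_set k)) (ld_topology M) ?\<tau>"
    by (rule continuous_map_eq) (simp add: ld_face_def)
  have graph: "definable R (Suc k + chart_dim M i)
      {Rn_pair (Suc k) x (coord M i (?\<tau> x)) | x. x \<in> simplex_set k \<and> ?\<tau> x \<in> chart M i}" (is "definable R _ ?G")
    if i: "i \<in> index M" for i
  proof -
    let ?H = "{Rn_pair (Suc (Suc k)) x (coord M i (\<sigma> x)) | x. x \<in> simplex_set (Suc k) \<and> \<sigma> x \<in> chart M i}"
    have H: "definable R (Suc (Suc k + chart_dim M i)) ?H" using \<sigma> i by (simp add: ld_simplices_iff)
    have push: "simplical_face j (Rn_pair (Suc k) x y) = Rn_pair (Suc (Suc k)) (simplical_face j x) y" for x y :: "nat \<Rightarrow> 'r"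
      using j by (auto simp: simplical_face_def Rn_pair_def fun_eq_iff Suc_diff_le)
    \<comment> \<open>The face map inserts a zero at position \<open>j\<close> below the last simplex coordinate, so it acts on
      graph points as the same insertion.\<close>
    have "?G = {e \<in> Rn (Suc k + chart_dim M i). simplical_face j e \<in> ?H}"
    proof (intro equalityI subsetI)
      fix e assume "e \<in> ?G"
      then obtain x where x: "x \<in> simplex_set k" "?\<tau> x \<in> chart M i" and e: "e = Rn_pair (Suc k) x (coord M i (?\<tau> x))"
        by blast
      have "e \<in> Rn (Suc k + chart_dim M i)"
        using coord_in_Rn[OF M i x(2)] unfolding e by (auto simp: Rn_def Rn_pair_def)
      moreover have "simplical_face j e \<in> ?H"
        using x face unfolding e push by (auto simp: \<tau>)
      ultimately show "e \<in> {e \<in> Rn (Suc k + chart_dim M i). simplical_face j e \<in> ?H}" by simp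
    next
      fix e assume "e \<in> {e \<in> Rn (Suc k + chart_dim M i). simplical_face j e \<in> ?H}"
      then obtain z where z: "z \<in> simplex_set (Suc k)" "\<sigma> z \<in> chart M i"
        and e: "simplical_face j e = Rn_pair (Suc (Suc k)) z (coord M i (\<sigma> z))" by blast
      \<comment> \<open>\<open>e\<close> is cut after its first \<open>Suc k\<close> coordinates.
        That the first block lies in the simplex is not known yet; it follows once its face is
        identified with \<open>z\<close>.\<close>
      define x where "x = (\<lambda>i. if i < Suc k then e i else 0)"
      define y where "y = (\<lambda>i. e (Suc k + i))"
      have exy: "e = Rn_pair (Suc k) x y" by (auto simp: x_def y_def Rn_pair_def)
      have "x \<in> Rn (Suc k)" by (simp add: x_def Rn_def)
      then have "simplical_face j x \<in> Rn (Suc (Suc k))" using j by (auto simp: Rn_def simplical_face_def)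
      then have fz: "simplical_face j x = z" "y = coord M i (\<sigma> z)"
        using e z(1) simplex_set_subset_Rn[of "Suc k"] unfolding exy push by (auto simp: Rn_pair_eq_iff)
      then have "x \<in> simplex_set k" using z(1) simplical_face_in_simplex_set_iff[OF j, of x] by simp
      then have "e = Rn_pair (Suc k) x (coord M i (?\<tau> x)) \<and> x \<in> simplex_set k \<and> ?\<tau> x \<in> chart M i"
        using fz z(2) exy \<tau>[of x] by simp
      then show "e \<in> ?G" by blast
    qed
    then show ?thesis using definable_simplical_face_vimage[OF H, of j] j by simp
  qed
  have "definable_subspace R M (?\<tau> ` simplex_set k)"
  proof -
    \<comment> \<open>The finitely many charts covering the image of \<open>\<sigma>\<close> also
      cover that of the face; in each of them the image is the projection of the graph just shown to
      be definable.\<close>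
    obtain J where J: "finite J" "J \<subseteq> index M" "\<sigma> ` simplex_set (Suc k) \<subseteq> (\<Union>j\<in>J. chart M j)"
      using \<sigma> by (auto simp: ld_simplices_iff definable_subspace_def)
    have "definable R (chart_dim M i) (coord M i ` (?\<tau> ` simplex_set k \<inter> chart M i))" if i: "i \<in> J" for i
    proof -
      let ?X = "{x \<in> simplex_set k. ?\<tau> x \<in> chart M i}"
      have iM: "i \<in> index M" using J i by auto
      have "definable R (chart_dim M i) ((\<lambda>x. coord M i (?\<tau> x)) ` (Rn (Suc k) \<inter> ?X))"
        using simplex_set_subset_Rn[of k] coord_in_Rn[OF M iM] graph[OF iM]
        by (intro definable_graph_image[OF definable_Rn]) auto
      moreover have "(\<lambda>x. coord M i (?\<tau> x)) ` (Rn (Suc k) \<inter> ?X) = coord M i ` (?\<tau> ` simplex_set k \<inter> chart M i)"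
        using simplex_set_subset_Rn[of k] by auto
      ultimately show ?thesis by simp
    qed
    then show ?thesis
      unfolding definable_subspace_def using J(1,2) order_trans[OF img J(3)]
      by (intro exI[of _ J] conjI ballI)
  qed
  moreover have "?\<tau> \<in> extensional (simplex_set k)" by (simp add: ld_face_def)
  moreover have "\<sigma> ` simplex_set (Suc k) \<subseteq> points M"
    using \<sigma> by (auto simp: ld_simplices_iff)
  then have "?\<tau> \<in> simplex_set k \<rightarrow> points M"
    unfolding image_subset_iff_funcset[symmetric] by (rule order_trans[OF img])
  ultimately show ?thesis
    using cont graph by (simp add: ld_simplices_iff)
qed

lemma ld_face_subspace:
  assumes M: "locally_definable_space R M" and Y: "Y \<subseteq> points M"
    and \<sigma>: "\<sigma> \<in> ld_simplices R (ld_subspace M Y) (Suc k)" and j: "j \<le> Suc k"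
  shows "ld_face (Suc k) j \<sigma> \<in> ld_simplices R (ld_subspace M Y) k"
  using \<sigma> ld_face_simplex[OF M _ j] simplical_face_in_simplex_set[OF _ j]
  by (auto simp: ld_simplices_subspace[OF M Y] ld_face_def)

section \<open>The boundary operator and the chain complex\<close>

lemma ld_boundary_diff: "ld_boundary k (a - b) = ld_boundary k a - ld_boundary k b"
  by (simp add: ld_boundary_def frag_extend_diff)

lemma ld_boundary_add: "ld_boundary k (a + b) = ld_boundary k a + ld_boundary k b"
  by (simp add: ld_boundary_def frag_extend_add)

lemma ld_boundary_cmul: "ld_boundary k (frag_cmul z a) = frag_cmul z (ld_boundary k a)"
  by (simp add: ld_boundary_def frag_extend_cmul)

lemma ld_boundary_sum: "finite I \<Longrightarrow> ld_boundary k (sum g I) = (\<Sum>i\<in>I. ld_boundary k (g i))"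
  by (simp add: ld_boundary_def frag_extend_sum comp_def)

lemma ld_boundary_of:
  "ld_boundary (Suc k) (frag_of \<sigma>) = (\<Sum>j\<le>Suc k. frag_cmul ((-1) ^ j) (frag_of (ld_face (Suc k) j \<sigma>)))"
  by (simp add: ld_boundary_def)

text \<open>The simplicial identity that pairs off the terms of a double boundary. The restrictions
  inside \<open>ld_face\<close> do no harm, because face inclusions map simplices to
  simplices.\<close>

lemma ld_face_ld_face:
  fixes \<sigma> :: "(nat \<Rightarrow> 'r::linordered_field) \<Rightarrow> 'm"
  assumes "i \<le> j" "j \<le> Suc k"
  shows "ld_face (Suc k) i (ld_face (Suc (Suc k)) (Suc j) \<sigma>) = ld_face (Suc k) j (ld_face (Suc (Suc k)) i \<sigma>)"
proof
  fix x :: "nat \<Rightarrow> 'r"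
  have "simplical_face (Suc j) (simplical_face i x) = simplical_face i (simplical_face j x)"
    using assms(1) by (auto simp: simplical_face_def fun_eq_iff)
  then show "ld_face (Suc k) i (ld_face (Suc (Suc k)) (Suc j) \<sigma>) x
      = ld_face (Suc k) j (ld_face (Suc (Suc k)) i \<sigma>) x"
    using assms simplical_face_in_simplex_set[of x k] by (simp add: ld_face_def)
qed

lemma ld_boundary_boundary: "ld_boundary k (ld_boundary (Suc k) c) = 0"
proof (cases k)
  case (Suc m)
  have "ld_boundary (Suc m) (ld_boundary (Suc (Suc m)) (frag_of \<sigma>)) = 0" for \<sigma> :: "(nat \<Rightarrow> 'a) \<Rightarrow> 'b"
  proof -
    let ?f = "\<lambda>(x, y). frag_cmul ((-1) ^ (x + y)) (frag_of (ld_face (Suc m) y (ld_face (Suc (Suc m)) x \<sigma>)))"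
    let ?A = "{..Suc (Suc m)} \<times> {..Suc m}"
    let ?B = "{(i, j). i \<le> j \<and> j \<le> Suc m}"
    \<comment> \<open>Here \<open>x\<close> is the face taken first and \<open>y\<close> the second.
      By the simplicial identity the term at \<open>(Suc j, i)\<close> has the same simplex as the
      term at \<open>(i, j)\<close>, and the exponent of its sign is larger by one; so
      \<open>?h\<close> matches the pairs with \<open>y < x\<close> to the remaining ones with
      opposite sign.\<close>
    let ?h = "\<lambda>(i, j). (Suc j, i)"
    have l: "?A \<inter> {(x, y). y < x} = ?h ` ?B"
    proof (intro equalityI subsetI)
      fix p assume "p \<in> ?A \<inter> {(x, y). y < x}"
      then obtain x y where "p = (x, y)" "x \<le> Suc (Suc m)" "y < x" by auto
      then have "p = ?h (y, x - 1)" "(y, x - 1) \<in> ?B" by auto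
      then show "p \<in> ?h ` ?B" by (rule image_eqI)
    qed auto
    have r: "?A - {(x, y). y < x} = ?B" by auto
    have inj: "inj_on ?h ?B" by (auto simp: inj_on_def)
    have "ld_boundary (Suc m) (ld_boundary (Suc (Suc m)) (frag_of \<sigma>)) = (\<Sum>x\<le>Suc (Suc m). \<Sum>y\<le>Suc m. ?f (x, y))"
      by (simp only: ld_boundary_of ld_boundary_sum finite_atMost ld_boundary_cmul frag_cmul_sum
          frag_cmul_cmul power_add comp_def prod.case)
    also have "\<dots> = sum ?f ?A" by (simp add: sum.cartesian_product del: sum.atMost_Suc)
    also have "\<dots> = sum ?f (?h ` ?B) + sum ?f ?B"
      using sum.Int_Diff[of ?A ?f "{(x, y). y < x}"] unfolding l r by simp
    also have "sum ?f (?h ` ?B) = (\<Sum>p\<in>?B. - ?f p)"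
      unfolding sum.reindex[OF inj] comp_def
      by (intro sum.cong refl) (auto simp: ld_face_ld_face add.commute)
    finally show ?thesis by (simp add: sum_negf)
  qed
  then show ?thesis
    unfolding Suc
    by (induction c rule: frag_induction[OF subset_UNIV]) (auto simp: ld_boundary_diff, simp_all add: ld_boundary_def)
qed (simp add: ld_boundary_def)

lemma keys_ld_boundary:
  assumes "Poly_Mapping.keys c \<subseteq> S (Suc k)"
    and "\<And>\<sigma> j. \<sigma> \<in> S (Suc k) \<Longrightarrow> j \<le> Suc k \<Longrightarrow> ld_face (Suc k) j \<sigma> \<in> S k"
  shows "Poly_Mapping.keys (ld_boundary (Suc k) c) \<subseteq> S k"
proof -
  have "Poly_Mapping.keys (\<Sum>j\<le>Suc k. frag_cmul ((-1) ^ j) (frag_of (ld_face (Suc k) j \<sigma>))) \<subseteq> S k"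
    if "\<sigma> \<in> S (Suc k)" for \<sigma>
    using that assms(2) by (intro keys_sum[THEN order_trans] UN_least) (auto simp: keys_cmul keys_frag_of split: if_splits)
  then show ?thesis
    unfolding ld_boundary_def if_not_P[OF nat.distinct(2)]
    by (intro keys_frag_extend[THEN order_trans] UN_least) (use assms(1) in blast)
qed

text \<open>Closure under faces is an assumption because it has two sources,
  \<open>ld_face_simplex\<close> for \<open>M\<close> and \<open>ld_face_subspace\<close> for
  subspaces. In this way \<open>ld_subspace M Y\<close> enters only through its set of
  simplices.\<close>

lemma chain_complex_ld_chains:
  assumes face: "\<And>k \<sigma> j. \<sigma> \<in> ld_simplices R M (Suc k) \<Longrightarrow> j \<le> Suc k \<Longrightarrow> ld_face (Suc k) j \<sigma> \<in> ld_simplices R M k"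
  shows "chain_complex (ld_chains R M)"
proof -
  have "Poly_Mapping.keys (ld_boundary k c) \<subseteq> ld_simplices R M (k - 1)"
    if "Poly_Mapping.keys c \<subseteq> ld_simplices R M k" for k c
  proof (cases k)
    case (Suc m)
    then show ?thesis using that keys_ld_boundary[of c "ld_simplices R M" m] face by simp
  qed (simp add: ld_boundary_def)
  then show ?thesis
    by (auto simp: chain_complex_def ld_chains_def abelian_free_Abelian_group ld_boundary_boundary
        ld_boundary_add intro!: homI)
qed

lemma ld_chain_map_id:
  assumes "Poly_Mapping.keys c \<subseteq> ld_simplices R M k"
  shows "ld_chain_map k id c = c"
proof -
  have "frag_extend (\<lambda>\<sigma>. frag_of (restrict (id \<circ> \<sigma>) (simplex_set k))) c = frag_extend frag_of c"
    using assms by (intro frag_extend_eq) (auto simp: ld_simplices_def extensional_restrict)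
  then show ?thesis by (simp add: ld_chain_map_def flip: frag_expansion)
qed

section \<open>Singular chains as a directed colimit\<close>

lemma complex_cocone_ld_chains:
  fixes R :: "('f, 'p, 'c::{linordered_field,linorder_topology}) expansion"
    and M :: "('d, 'e, 'c) atlas"
  assumes M: "locally_definable_space R M"
  shows "complex_cocone (definable_subspaces R M) (\<lambda>Y. ld_chains R (ld_subspace M Y))
           (\<lambda>Y Z k. ld_chain_map k id) (ld_chains R M) (\<lambda>Y k. ld_chain_map k id)"
proof (rule complex_cocone.intro)
  let ?D = "definable_subspaces R M"
  have D: "Y \<subseteq> points M" if "Y \<in> ?D" for Y
    using that definable_subspace_subset[OF M] by (simp add: definable_subspaces_def)
  show cL: "chain_complex (ld_chains R M)"
    by (intro chain_complex_ld_chains ld_face_simplex M)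
  show cC: "chain_complex (ld_chains R (ld_subspace M Y))" if "Y \<in> ?D" for Y
    by (intro chain_complex_ld_chains ld_face_subspace M D that)
  have keys: "Poly_Mapping.keys c \<subseteq> ld_simplices R (ld_subspace M Y) k \<longleftrightarrow>
      Poly_Mapping.keys c \<subseteq> ld_simplices R M k \<and> (\<forall>\<sigma>\<in>Poly_Mapping.keys c. \<sigma> ` simplex_set k \<subseteq> Y)"
    if "Y \<in> ?D" for Y k c
    unfolding ld_simplices_subspace[OF M D[OF that]] by blast
  have car: "c \<in> carrier (grp (ld_chains R N) k) \<longleftrightarrow> Poly_Mapping.keys c \<subseteq> ld_simplices R N k"
    for N :: "('d, 'e, 'c) atlas" and k c by (simp add: ld_chains_def)
  have id: "ld_chain_map k id c = c" if "c \<in> carrier (grp (ld_chains R N) k)"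
    for N :: "('d, 'e, 'c) atlas" and k c using that unfolding car by (rule ld_chain_map_id)
  have bdc: "bd (ld_chains R N) k c \<in> carrier (grp (ld_chains R N) (k - 1))"
    if "c \<in> carrier (grp (ld_chains R N) k)" "chain_complex (ld_chains R N)"
    for N :: "('d, 'e, 'c) atlas" and k c
    using that by (auto simp: chain_complex_def dest: hom_in_carrier)
  have bd: "bd (ld_chains R N) = ld_boundary" for N :: "('d, 'e, 'c) atlas"
    by (simp add: ld_chains_def)
  show "bd (ld_chains R (ld_subspace M Z)) k (ld_chain_map k id c)
      = ld_chain_map (k - 1) id (bd (ld_chains R (ld_subspace M Y)) k c)"
    if "Y \<in> ?D" "c \<in> carrier (grp (ld_chains R (ld_subspace M Y)) k)" for Y Z k c
    using id[OF that(2)] id[OF bdc[OF that(2) cC[OF that(1)]]] by (simp add: bd)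
  show "bd (ld_chains R M) k (ld_chain_map k id c)
      = ld_chain_map (k - 1) id (bd (ld_chains R (ld_subspace M Y)) k c)"
    if "Y \<in> ?D" "c \<in> carrier (grp (ld_chains R (ld_subspace M Y)) k)" for Y k c
    using id[OF that(2)] id[OF bdc[OF that(2) cC[OF that(1)]]] by (simp add: bd)
  fix k
  have sub: "c \<in> carrier (grp (ld_chains R M) k)"
    if "Y \<in> ?D" "c \<in> carrier (grp (ld_chains R (ld_subspace M Y)) k)" for Y c
    using that keys[OF that(1)] unfolding car by blast
  have mono: "c \<in> carrier (grp (ld_chains R (ld_subspace M Z)) k)"
    if "Y \<in> ?D" "Z \<in> ?D" "Y \<subseteq> Z" "c \<in> carrier (grp (ld_chains R (ld_subspace M Y)) k)" for Y Z c
    using that(3,4) unfolding car keys[OF that(1)] keys[OF that(2)] by blast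
  show "directed_cocone ?D (\<lambda>Y. grp (ld_chains R (ld_subspace M Y)) k)
     (\<lambda>Y Z. ld_chain_map k id) (grp (ld_chains R M) k) (\<lambda>Y. ld_chain_map k id)"
  proof (rule directed_cocone.intro)
    show "?D \<noteq> {}" using definable_subspace_empty[of R M] by (auto simp: definable_subspaces_def)
    show "\<exists>W\<in>?D. Y \<union> Z \<subseteq> W" if "Y \<in> ?D" "Z \<in> ?D" for Y Z
      using that definable_subspace_Un[OF M] by (auto simp: definable_subspaces_def)
    show "comm_group (grp (ld_chains R M) k)" using cL by (simp add: chain_complex_def)
    show "comm_group (grp (ld_chains R (ld_subspace M Y)) k)" if "Y \<in> ?D" for Y
      using cC[OF that] by (simp add: chain_complex_def)
    have add: "ld_chain_map k id (a \<otimes>\<^bsub>grp (ld_chains R N) k\<^esub> b)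
        = ld_chain_map k id a \<otimes>\<^bsub>grp (ld_chains R N') k\<^esub> ld_chain_map k id b"
      for N N' :: "('d, 'e, 'c) atlas" and a b :: "('c, 'e) ld_chain"
      by (simp add: ld_chains_def ld_chain_map_def frag_extend_add)
    show "ld_chain_map k id \<in> hom (grp (ld_chains R (ld_subspace M Y)) k) (grp (ld_chains R (ld_subspace M Z)) k)"
      if "Y \<in> ?D" "Z \<in> ?D" "Y \<subseteq> Z" for Y Z
      using mono[OF that] by (intro homI add) (simp add: id)
    show "ld_chain_map k id \<in> hom (grp (ld_chains R (ld_subspace M Y)) k) (grp (ld_chains R M) k)"
      if "Y \<in> ?D" for Y
      using sub[OF that] by (intro homI add) (simp add: id)
    fix x assume x: "x \<in> carrier (grp (ld_chains R M) k)"
    let ?Y = "\<Union>\<sigma>\<in>Poly_Mapping.keys x. \<sigma> ` simplex_set k"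
    have Y: "?Y \<in> ?D"
      using x unfolding definable_subspaces_def car
      by (auto intro!: definable_subspace_Union[OF M] simp: ld_simplices_iff)
    have "x \<in> carrier (grp (ld_chains R (ld_subspace M ?Y)) k)"
      using x unfolding car keys[OF Y] by blast
    with Y show "\<exists>Y\<in>?D. \<exists>c\<in>carrier (grp (ld_chains R (ld_subspace M Y)) k). ld_chain_map k id c = x"
      using id by blast
  next
    \<comment> \<open>On chains the kernel condition holds with \<open>Z = Y\<close>: the inclusion
      acts as the identity, so only the zero chain goes to zero.\<close>
    fix Y c assume Y: "Y \<in> ?D" and c: "c \<in> carrier (grp (ld_chains R (ld_subspace M Y)) k)"
      and "ld_chain_map k id c = \<one>\<^bsub>grp (ld_chains R M) k\<^esub>"
    then show "\<exists>Z\<in>?D. Y \<subseteq> Z \<and> ld_chain_map k id c = \<one>\<^bsub>grp (ld_chains R (ld_subspace M Z)) k\<^esub>"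
      by (auto simp: ld_chains_def)
  qed (simp_all add: id[OF mono] id)
qed

lemma complex_cocone_ld_rel_chains:
  fixes R :: "('f, 'p, 'c::{linordered_field,linorder_topology}) expansion"
    and M :: "('d, 'e, 'c) atlas"
  assumes M: "locally_definable_space R M" and A: "A \<subseteq> points M"
  shows "complex_cocone (definable_subspaces R M) (\<lambda>Y. ld_rel_chains R (ld_subspace M Y) (A \<inter> Y))
           (\<lambda>Y Z k. coset_map (grp (ld_chains R (ld_subspace M Z)) k)
               (carrier (grp (ld_chains R (ld_subspace (ld_subspace M Z) (A \<inter> Z))) k)) (ld_chain_map k id))
           (ld_rel_chains R M A)
           (\<lambda>Y k. coset_map (grp (ld_chains R M) k) (carrier (grp (ld_chains R (ld_subspace M A)) k))
               (ld_chain_map k id))"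
proof -
  interpret complex_cocone "definable_subspaces R M" "\<lambda>Y. ld_chains R (ld_subspace M Y)"
    "\<lambda>Y Z k. ld_chain_map k id" "ld_chains R M" "\<lambda>Y k. ld_chain_map k id"
    by (rule complex_cocone_ld_chains[OF M])
  let ?D = "definable_subspaces R M"
  have D: "Y \<subseteq> points M" if "Y \<in> ?D" for Y
    using that definable_subspace_subset[OF M] by (simp add: definable_subspaces_def)
  have sub: "subgroup (carrier (grp (ld_chains R N) k)) (grp (ld_chains R N') k)"
    if "ld_simplices R N k \<subseteq> ld_simplices R N' k" for N N' :: "('d, 'e, 'c) atlas" and k
  proof (rule group.subgroupI)
    show "inv\<^bsub>grp (ld_chains R N') k\<^esub> a \<in> carrier (grp (ld_chains R N) k)"
      if "a \<in> carrier (grp (ld_chains R N) k)" for a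
      using that \<open>ld_simplices R N k \<subseteq> ld_simplices R N' k\<close> by (simp add: ld_chains_def order_trans)
    show "a \<otimes>\<^bsub>grp (ld_chains R N') k\<^esub> b \<in> carrier (grp (ld_chains R N) k)"
      if "a \<in> carrier (grp (ld_chains R N) k)" "b \<in> carrier (grp (ld_chains R N) k)" for a b
      using that keys_add[of a b] by (auto simp: ld_chains_def)
    show "carrier (grp (ld_chains R N) k) \<noteq> {}"
      using group.is_monoid[OF group_free_Abelian_group] monoid.one_closed by (auto simp: ld_chains_def)
  qed (use that in \<open>auto simp: ld_chains_def\<close>)
  note simps = ld_simplices_subspace[OF M]
  have bd: "bd (ld_chains R N) k ` carrier (grp (ld_chains R (ld_subspace M B)) k)
      \<subseteq> carrier (grp (ld_chains R (ld_subspace M B)) (k - 1))"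
    if "B \<subseteq> points M" for N :: "('d, 'e, 'c) atlas" and B k
    using chain_complex_ld_chains[OF ld_face_subspace[OF M that]]
    by (auto simp: chain_complex_def ld_chains_def dest: hom_in_carrier)
  have id: "ld_chain_map k id c = c" if "c \<in> carrier (grp (ld_chains R N) k)"
    for N :: "('d, 'e, 'c) atlas" and k c using that ld_chain_map_id by (simp add: ld_chains_def)
  \<comment> \<open>Both members of the pair \<open>(Y, A \<inter> Y)\<close> are rewritten as
    subspaces of \<open>M\<close>, so all chain groups involved can be compared inside the chains of
    \<open>M\<close>.\<close>
  have eq: "ld_subspace (ld_subspace M Y) (A \<inter> Y) = ld_subspace M (A \<inter> Y)" for Y
    by (simp add: ld_subspace_subspace)
  have AY: "A \<inter> Y \<subseteq> points M" for Y using A by auto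
  have mono: "carrier (grp (ld_chains R (ld_subspace M B)) k) \<subseteq> carrier (grp (ld_chains R (ld_subspace M B')) k)"
    if "B \<subseteq> B'" "B' \<subseteq> points M" for B B' k
    using that simps[of B k] simps[of B' k] by (force simp: ld_chains_def)
  show ?thesis
    unfolding ld_rel_chains_def eq
  proof (rule quotient_cocone)
    fix Y k assume Y: "Y \<in> ?D"
    show "subgroup (carrier (grp (ld_chains R (ld_subspace M (A \<inter> Y))) k)) (grp (ld_chains R (ld_subspace M Y)) k)"
      by (rule sub) (auto simp: simps AY D Y)
    show "ld_chain_map k id ` carrier (grp (ld_chains R (ld_subspace M (A \<inter> Y))) k)
        \<subseteq> carrier (grp (ld_chains R (ld_subspace M A)) k)"
      using mono[of "A \<inter> Y" A] A by (auto simp: id)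
    show "ld_chain_map k id ` carrier (grp (ld_chains R (ld_subspace M (A \<inter> Y))) k)
        \<subseteq> carrier (grp (ld_chains R (ld_subspace M (A \<inter> Z))) k)" if "Z \<in> ?D" "Y \<subseteq> Z" for Z
      using mono[of "A \<inter> Y" "A \<inter> Z"] AY that by (auto simp: id)
    fix c assume c: "c \<in> carrier (grp (ld_chains R (ld_subspace M Y)) k)"
      and "ld_chain_map k id c \<in> carrier (grp (ld_chains R (ld_subspace M A)) k)"
    \<comment> \<open>The condition \<open>uN\<close> needs no larger stage: a chain of
      \<open>Y\<close> that is a chain of \<open>A\<close> already belongs to the subgroup divided
      out over \<open>Y\<close>.\<close>
    moreover have inter: "ld_simplices R (ld_subspace M (A \<inter> Y)) k
        = ld_simplices R (ld_subspace M A) k \<inter> ld_simplices R (ld_subspace M Y) k"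
      by (auto simp: simps A AY D Y)
    ultimately have "ld_chain_map k id c \<in> carrier (grp (ld_chains R (ld_subspace M (A \<inter> Y))) k)"
      using c unfolding id[OF c] by (simp add: ld_chains_def inter)
    then show "\<exists>Z\<in>?D. Y \<subseteq> Z \<and> ld_chain_map k id c \<in> carrier (grp (ld_chains R (ld_subspace M (A \<inter> Z))) k)"
      using Y by blast
  next
    show "subgroup (carrier (grp (ld_chains R (ld_subspace M A)) k)) (grp (ld_chains R M) k)" for k
      by (rule sub) (auto simp: simps A)
  qed (intro bd A AY)+
qed

theorem theorem3p1:
  fixes R :: "('f, 'p, 'r::{real_closed_field,linorder_topology}) expansion"
    and M :: "('i, 'm, 'r) atlas"
    and n :: nat
  assumes "o_minimal R" and "LD_space R M"
  shows
    "((\<forall>Y\<in>definable_subspaces R M. \<forall>c\<in>carrier (sub_homology R M n Y).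
         psi R M n
           (dirlim_class (definable_subspaces R M) (sub_homology R M n) (incl_homology R M n) Y c)
         = ld_homology_map R M n id c) \<and>
      psi R M n \<in>
        iso (dirlim (definable_subspaces R M) (sub_homology R M n) (incl_homology R M n))
            (ld_homology R M n)) \<and>
     (\<forall>A. admissible_subspace R M A \<longrightarrow>
        (\<forall>Y\<in>definable_subspaces R M. \<forall>c\<in>carrier (sub_rel_homology R M A n Y).
           psi_rel R M A n
             (dirlim_class (definable_subspaces R M)
                (sub_rel_homology R M A n) (incl_rel_homology R M A n) Y c)
           = ld_rel_homology_map R M A n id c) \<and>
        psi_rel R M A n \<in>
          iso (dirlim (definable_subspaces R M)
                 (sub_rel_homology R M A n) (incl_rel_homology R M A n))
              (ld_rel_homology R M A n))"
proof -
  have M: "locally_definable_space R M"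
    using assms(2) by (simp add: LD_space_def ld_space_def)
  \<comment> \<open>Transition maps and maps to \<open>M\<close> are both induced by
    \<open>id\<close> on chains and differ only in the complex whose boundaries are divided
    out.\<close>
  interpret H: directed_cocone "definable_subspaces R M" "sub_homology R M n" "incl_homology R M n"
    "ld_homology R M n" "\<lambda>Y. ld_homology_map R M n id"
    using complex_cocone.homology_cocone[OF complex_cocone_ld_chains[OF M], of n]
    by (simp add: sub_homology_def[abs_def] incl_homology_def[abs_def] ld_homology_def
        ld_homology_map_def[abs_def])
  have rel: "directed_cocone (definable_subspaces R M) (sub_rel_homology R M A n)
      (incl_rel_homology R M A n) (ld_rel_homology R M A n) (\<lambda>Y. ld_rel_homology_map R M A n id)"
    if "admissible_subspace R M A" for A
  proof -
    have "A \<subseteq> points M" using that by (simp add: admissible_subspace_def)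
    from complex_cocone.homology_cocone[OF complex_cocone_ld_rel_chains[OF M this], of n]
    show ?thesis
      by (simp add: sub_rel_homology_def[abs_def] incl_rel_homology_def[abs_def] ld_rel_homology_def
          ld_rel_homology_map_def[abs_def])
  qed
  show ?thesis
    unfolding psi_def psi_rel_def
    using H.dirlim_map_class H.dirlim_map_iso directed_cocone.dirlim_map_class[OF rel]
      directed_cocone.dirlim_map_iso[OF rel]
    by blast
qed

end
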